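(* Suppose that the mesh-refinement satisfies the son estimate, the overlay estimate, and the closure estimate. Assume moreover that there exist $C_{\rm est},C_{\rm stab}>0$ such that (1) for all $\mathcal T_H\in\mathbb T$, $\mathcal M_H\subseteq\mathcal T_H$, and $\mathcal T_h:=\mathrm{refine}(\mathcal T_H,\mathcal M_H)$, $$C_{\rm est}^{-1}\,\tau_H(\mathcal M_H)\le |||u_h-u_H|||\le C_{\rm est}\,\tau_H(\mathcal T_H\setminus\mathcal T_h);$$ (2) for all $\mathcal T_H\in\mathbb T$ and all $\mathcal T_h\in\mathrm{refine}(\mathcal T_H)$, $$|\tau_h(\mathcal T_H\cap\mathcal T_h)-\tau_H(\mathcal T_H\cap\mathcal T_h)|\le C_{\rm stab}\,|||u_h-u_H|||.$$ Consider the output $(\mathcal T_\ell,u_\ell,\tau_\ell)_{\ell\in\mathbb N_0}$ of the adaptive algorithm for fixed parameters $0<\theta\le1$ and $1\le C_{\rm mark}<\infty$. Suppose that the strong saturation assumption holds with constants $0<\kappa_{\rm sat}\le q_{\rm sat}<1$. Then there exists $0<\theta_{\rm opt}\le1$ such that, if $0<\theta<\theta_{\rm opt}$, then for all $s>0$ there exists $C_{\rm opt}>0$ with $$C_{\rm opt}^{-1}\,\|u\|_{\mathbb A_s}\le\sup_{\ell\in\mathbb N_0}(\#\mathcal T_\ell)^s\,|||u-u_\ell|||\le C_{\rm opt}\,\|u\|_{\mathbb A_s}.$$ The constant $C_{\rm opt}$ depends only on $\theta$, $s$, $\kappa_{\rm sat}$, $q_{\rm sat}$, $\mathcal T_0$,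 and on the linear-convergence index $\ell_0$ (an index $\ell_0\in\mathbb N_0$ for which there is $0<q_{\rm lin}<1$ with $|||u-u_{\ell+1}|||\le q_{\rm lin}|||u-u_\ell|||$ for all $\ell\ge\ell_0$).
   Context: **Problem.** $\mathcal H$ is a (real or complex) Hilbert space with scalar product $\langle\!\langle\cdot,\cdot\rangle\!\rangle$ and norm $|||\cdot|||$; $\mathcal H'$ is its dual space, with duality brackets $\langle\cdot,\cdot\rangle$ on $\mathcal H'\times\mathcal H$ (in the complex case all forms are sesquilinear). $\mathcal K:\mathcal H\to\mathcal H'$ is a compact (linear) operator, $F\in\mathcal H'$, and it is assumed that the problem $$b(u,v):=\langle\!\langle u,v\rangle\!\rangle+\langle\mathcal Ku,v\rangle=F(v)\quad\text{for all }v\in\mathcal H$$ has a unique solution $u\in\mathcal H$. **Meshes and refinement.** A mesh (triangulation) is a finite set of elements. A mesh-refinement algorithm is fixed: for a mesh $\mathcal T_H$ and a set of marked elements $\mathcal M_H\subseteq\mathcal T_H$, $\mathrm{refine}(\mathcal T_H,\mathcal M_H)$ is the coarsest refinement $\mathcal T_h$ of $\mathcal T_H$ such that all marked elements are refined, i.e., $\mathcal M_H\subseteq\mathcal T_H\setminus\mathcal T_h$. One writes $\mathcal T_h\in\mathrm{refine}(\mathcal T_H)$ if $\mathcal T_h$ is obtained from $\mathcal T_H$ by finitely many steps of refinement. The set of admissible meshes is $\mathbb T=\mathrm{refine}(\mathcal T_0)$ for a fixed initial mesh $\mathcal T_0$. The uniform refinement of $\mathcal T_H$ is $\widehat{\mathcal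 T}_H:=\mathrm{refine}(\mathcal T_H,\mathcal T_H)$. *Son estimate:* there is a constant $C_{\rm son}\ge2$ such that, whenever $\mathcal T_H,\mathcal T_h\in\mathbb T$ satisfy $\mathcal T_h=\mathrm{refine}(\mathcal T_H,\mathcal M_H)$ for some $\mathcal M_H\subseteq\mathcal T_H$, every $T\in\mathcal T_H$ satisfies $T=\bigcup\{T'\in\mathcal T_h:T'\subseteq T\}$ and $\#\{T'\in\mathcal T_h:T'\subseteq T\}\le C_{\rm son}$. *Overlay estimate:* for all $\mathcal T,\mathcal T'\in\mathbb T$ there is a coarsest common refinement $\mathcal T\oplus\mathcal T'\in\mathrm{refine}(\mathcal T)\cap\mathrm{refine}(\mathcal T')$, and $\#(\mathcal T\oplus\mathcal T')\le\#\mathcal T+\#\mathcal T'-\#\mathcal T_0$. *Closure estimate:* there is $C_{\rm mesh}>0$ depending only on $\mathcal T_0$ such that for all sequences with $\mathcal T_{\ell+1}=\mathrm{refine}(\mathcal T_\ell,\mathcal M_\ell)$, with arbitrary $\mathcal M_\ell\subseteq\mathcal T_\ell$, it holds that $\#\mathcal T_\ell-\#\mathcal T_0\le C_{\rm mesh}\sum_{j=0}^{\ell-1}\#\mathcal M_j$ for all $\ell\in\mathbb N_0$. **Discretization.** With each $\mathcal T_H\in\mathbb T$ is associated a finite-dimensional subspace $\mathcal X_H\subset\mathcal H$, nested in the sense that $\mathcal X_H\subseteq\mathcal X_h$ for all $\mathcal T_h\in\mathrm{refine}(\mathcal T_H)$. It is assumed that there is $\gamma_0>0$ with $$\inf_{w_H\in\mathcal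 X_H\setminus\{0\}}\ \sup_{v_H\in\mathcal X_H\setminus\{0\}}\frac{|b(w_H,v_H)|}{|||w_H|||\,|||v_H|||}\ge\gamma_0\quad\text{for all }\mathcal T_H\in\mathbb T .$$ Hence there is a unique Galerkin solution $u_H\in\mathcal X_H$ with $b(u_H,v_H)=F(v_H)$ for all $v_H\in\mathcal X_H$. It is assumed that $\inf_{\mathcal T_H\in\mathbb T}\min_{v_H\in\mathcal X_H}|||v-v_H|||=0$ for all $v\in\mathcal H$, and it is understood that this is realized by uniform refinement of any mesh: for every $\mathcal T_H\in\mathbb T$, $v\in\mathcal H$ and $\varepsilon>0$ there is $\mathcal T_h\in\mathrm{refine}(\mathcal T_H)$ with $\mathcal T_H\cap\mathcal T_h=\emptyset$ and $\min_{v_h\in\mathcal X_h}|||v-v_h|||\le\varepsilon$. Indices of objects follow the mesh: $u_H,u_h,u_\ell$ are the Galerkin solutions for $\mathcal T_H,\mathcal T_h,\mathcal T_\ell$, etc. **Two-level estimator.** For $\mathcal T_H\in\mathbb T$ let $\mathcal I_H\subseteq\widehat{\mathcal I}_H$ be index sets of the degrees of freedom of $\mathcal X_H$ and of the space $\widehat{\mathcal X}_H$ associated with $\widehat{\mathcal T}_H$. For $z\in\widehat{\mathcal I}_H\setminus\mathcal I_H$ an error indicator $\tau_H(z)\ge0$ is given. For $T\in\mathcal T_H$, $\widehat{\mathcal I}_H(T)$ denotes the corresponding degrees of freedom, and $\widehat{\mathcal I}_H\setminus\mathcal I_H$ is the (in general non-disjoint) union of the sets $\widehat{\mathcal I}_H(T)\setminus\mathcal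 I_H$, $T\in\mathcal T_H$. Define $$\tau_H(T)^2:=\sum_{z\in\widehat{\mathcal I}_H(T)\setminus\mathcal I_H}\tau_H(z)^2,\qquad \tau_H(\mathcal U_H):=\Big(\sum_{T\in\mathcal U_H}\tau_H(T)^2\Big)^{1/2}\ (\mathcal U_H\subseteq\mathcal T_H),\qquad \tau_H:=\tau_H(\mathcal T_H).$$ **Adaptive algorithm.** Input: $\mathcal T_0$, $0<\theta\le1$, $1\le C_{\rm mark}\le\infty$. For $\ell=0,1,2,\dots$: (i) compute $u_\ell\in\mathcal X_\ell$; (ii) compute $\tau_\ell(T)$ for all $T\in\mathcal T_\ell$; (iii) determine $\mathcal M_\ell\subseteq\mathcal T_\ell$ with $\theta\,\tau_\ell^2\le\tau_\ell(\mathcal M_\ell)^2$ whose cardinality is at most $C_{\rm mark}$ times the minimal cardinality of a set with this property; (iv) set $\mathcal T_{\ell+1}:=\mathrm{refine}(\mathcal T_\ell,\mathcal M_\ell)$. **Strong saturation assumption** (constants $0<\kappa_{\rm sat}\le q_{\rm sat}<1$): for all $\ell\in\mathbb N_0$ and all $\mathcal T_h\in\mathrm{refine}(\mathcal T_\ell)$, the mesh $\mathcal T_H:=\mathrm{refine}(\mathcal T_\ell,\mathcal T_\ell\setminus\mathcal T_h)$ satisfies: if $|||u-u_h|||\le\kappa_{\rm sat}|||u-u_\ell|||$, then $|||u-u_H|||\le q_{\rm sat}|||u-u_\ell|||$. **Approximation constant.** For $N\in\mathbb N_0$ let $\mathbb T(N):=\{\mathcal T_H\in\mathbb T:\#\mathcal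 T_H-\#\mathcal T_0\le N\}$ (a finite set). For $s>0$, $$\|u\|_{\mathbb A_s}:=\sup_{N\in\mathbb N_0}\ \min_{\mathcal T_{\rm opt}\in\mathbb T(N)}\ \min_{v_{\rm opt}\in\mathcal X_{\rm opt}}(N+1)^s\,|||u-v_{\rm opt}|||\in[0,\infty].$$ *)

theory Defs
  imports "HOL-Analysis.Analysis"
begin

text \<open>
  The axioms make \<open>x + kcnj x = norm (1 + x)\<^sup>2 - 1 - (norm x)\<^sup>2\<close> real, so every scalar is
  a root of a real quadratic polynomial: up to isomorphism, the only members of this class are
  the real numbers (with the identity) and the complex numbers (with conjugation).
\<close>

class real_or_complex = real_normed_field +
  fixes kcnj :: "'a \<Rightarrow> 'a"
  assumes kcnj_add: "kcnj (x + y) = kcnj x + kcnj y"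
    and kcnj_mult: "kcnj (x * y) = kcnj x * kcnj y"
    and kcnj_kcnj: "kcnj (kcnj x) = x"
    and kcnj_scaleR_1: "kcnj (r *\<^sub>R 1) = r *\<^sub>R 1"
    and mult_kcnj: "x * kcnj x = (norm x)\<^sup>2 *\<^sub>R 1"

instantiation real :: real_or_complex
begin
definition kcnj_real :: "real \<Rightarrow> real" where "kcnj_real x = x"
instance by standard (simp_all add: kcnj_real_def power2_eq_square)
end

instantiation complex :: real_or_complex
begin
definition kcnj_complex :: "complex \<Rightarrow> complex" where "kcnj_complex = cnj"
instance
  by standard
    (simp_all add: kcnj_complex_def scaleR_conv_of_real complex_norm_square[symmetric] del: of_real_power)
end

text \<open>
  Sesquilinear forms are linear in the first and conjugate linear in the second argument.
  Completeness and the norm come from the type class \<^class>\<open>banach\<close>.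
\<close>

locale hilbert_space = vector_space smul
  for smul :: "'k::real_or_complex \<Rightarrow> 'h::banach \<Rightarrow> 'h" +
  fixes ip :: "'h \<Rightarrow> 'h \<Rightarrow> 'k"
  assumes scale_of_real: "smul (of_real r) x = r *\<^sub>R x"
    and ip_add_left: "ip (x + y) z = ip x z + ip y z"
    and ip_scale_left: "ip (smul a x) y = a * ip x y"
    and ip_commute: "ip y x = kcnj (ip x y)"
    and ip_self: "ip x x = of_real ((norm x)\<^sup>2)"

text \<open>
  As the duality bracket is conjugate linear in its second argument, the dual space consists of
  the bounded conjugate linear functionals; its norm is the operator norm of
  \<^typ>\<open>'h \<Rightarrow>\<^sub>L 'k\<close>.
\<close>

definition dual_space ::
  "('k::real_or_complex \<Rightarrow> 'h::banach \<Rightarrow> 'h) \<Rightarrow> ('h \<Rightarrow>\<^sub>L 'k) set"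
where
  "dual_space smul =
     {\<phi>. \<forall>a x. blinfun_apply \<phi> (smul a x) = kcnj a * blinfun_apply \<phi> x}"

definition compact_operator ::
  "('k::real_or_complex \<Rightarrow> 'h::banach \<Rightarrow> 'h) \<Rightarrow> ('h \<Rightarrow> ('h \<Rightarrow>\<^sub>L 'k)) \<Rightarrow> bool"
where
  "compact_operator smul K \<longleftrightarrow>
     (\<forall>x. K x \<in> dual_space smul) \<and>
     (\<forall>x y. K (x + y) = K x + K y) \<and>
     (\<forall>a x v. blinfun_apply (K (smul a x)) v = a * blinfun_apply (K x) v) \<and>
     (\<forall>S. bounded S \<longrightarrow> compact (closure (K ` S)))"

definition bform ::
  "('h \<Rightarrow> 'h \<Rightarrow> 'k) \<Rightarrow> ('h \<Rightarrow> ('h \<Rightarrow>\<^sub>L 'k)) \<Rightarrow> 'h \<Rightarrow> 'h::banach \<Rightarrow> 'k::real_or_complex"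
where
  "bform ip K w v = ip w v + blinfun_apply (K w) v"

text \<open>Elements are point sets, so that \<open>T' \<subseteq> T\<close> makes sense for elements.\<close>

type_synonym 'p mesh = "'p set set"

inductive_set refinements :: "('p mesh \<Rightarrow> 'p mesh \<Rightarrow> 'p mesh) \<Rightarrow> 'p mesh \<Rightarrow> 'p mesh set"
  for refine :: "'p mesh \<Rightarrow> 'p mesh \<Rightarrow> 'p mesh" and TH :: "'p mesh"
where
  refinements_refl: "TH \<in> refinements refine TH"
| refinements_step:
    "Th \<in> refinements refine TH \<Longrightarrow> M \<subseteq> Th \<Longrightarrow> refine Th M \<in> refinements refine TH"

text \<open>
  \<open>nonempty\<close> and \<open>nonoverlapping\<close> express that meshes are triangulations: distinct elements
  of a mesh intersect at most in lower-dimensional sets, so no element of a refinement lies in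
  two of them.  Without this, refinement could decrease the number of elements.
\<close>

locale mesh_refinement =
  fixes refine :: "'p mesh \<Rightarrow> 'p mesh \<Rightarrow> 'p mesh" and T0 :: "'p mesh"
  assumes finite_mesh: "TH \<in> refinements refine T0 \<Longrightarrow> finite TH"
    and nonempty: "TH \<in> refinements refine T0 \<Longrightarrow> T \<in> TH \<Longrightarrow> T \<noteq> {}"
    and nonoverlapping:
      "TH \<in> refinements refine T0 \<Longrightarrow> Th \<in> refinements refine TH \<Longrightarrow>
       T1 \<in> TH \<Longrightarrow> T2 \<in> TH \<Longrightarrow> T' \<in> Th \<Longrightarrow> T' \<subseteq> T1 \<Longrightarrow> T' \<subseteq> T2 \<Longrightarrow> T1 = T2"
    and marked_refined:
      "TH \<in> refinements refine T0 \<Longrightarrow> MH \<subseteq> TH \<Longrightarrow> MH \<subseteq> TH - refine TH MH"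
    and coarsest:
      "TH \<in> refinements refine T0 \<Longrightarrow> MH \<subseteq> TH \<Longrightarrow> Th \<in> refinements refine TH \<Longrightarrow>
       MH \<subseteq> TH - Th \<Longrightarrow> Th \<in> refinements refine (refine TH MH)"

definition son_estimate ::
  "('p mesh \<Rightarrow> 'p mesh \<Rightarrow> 'p mesh) \<Rightarrow> 'p mesh \<Rightarrow> real \<Rightarrow> bool"
where
  "son_estimate refine T0 Cson \<longleftrightarrow>
     2 \<le> Cson \<and>
     (\<forall>TH\<in>refinements refine T0. \<forall>Th\<in>refinements refine T0. \<forall>MH.
        MH \<subseteq> TH \<and> Th = refine TH MH \<longrightarrow>
        (\<forall>T\<in>TH. T = \<Union>{T'\<in>Th. T' \<subseteq> T} \<and> real (card {T'\<in>Th. T' \<subseteq> T}) \<le> Cson))"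

definition overlay_estimate ::
  "('p mesh \<Rightarrow> 'p mesh \<Rightarrow> 'p mesh) \<Rightarrow> 'p mesh \<Rightarrow> bool"
where
  "overlay_estimate refine T0 \<longleftrightarrow>
     (\<forall>T\<in>refinements refine T0. \<forall>T'\<in>refinements refine T0.
        \<exists>S \<in> refinements refine T \<inter> refinements refine T'.
          (\<forall>R \<in> refinements refine T \<inter> refinements refine T'. R \<in> refinements refine S) \<and>
          int (card S) \<le> int (card T) + int (card T') - int (card T0))"

definition closure_estimate ::
  "('p mesh \<Rightarrow> 'p mesh \<Rightarrow> 'p mesh) \<Rightarrow> 'p mesh \<Rightarrow> real \<Rightarrow> bool"
where
  "closure_estimate refine T0 Cmesh \<longleftrightarrow>
     0 < Cmesh \<and>
     (\<forall>(T :: nat \<Rightarrow> 'p mesh) M.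
        T 0 = T0 \<and> (\<forall>l. M l \<subseteq> T l \<and> T (Suc l) = refine (T l) (M l)) \<longrightarrow>
        (\<forall>l. real (card (T l)) - real (card T0) \<le> Cmesh * (\<Sum>j<l. real (card (M j)))))"

text \<open>
  The infimum and supremum are taken in \<^typ>\<open>ennreal\<close>, so that the condition is void for
  the trivial space.
\<close>

definition inf_sup_stable :: "('h::banach \<Rightarrow> 'h \<Rightarrow> 'k::real_or_complex) \<Rightarrow> 'h set \<Rightarrow> real \<Rightarrow> bool"
where
  "inf_sup_stable b X \<gamma> \<longleftrightarrow>
     ennreal \<gamma> \<le> (INF w\<in>X - {0}. SUP v\<in>X - {0}. ennreal (norm (b w v) / (norm w * norm v)))"

definition discretization ::
  "('k::real_or_complex \<Rightarrow> 'h::banach \<Rightarrow> 'h) \<Rightarrow> ('h \<Rightarrow> 'h \<Rightarrow> 'k) \<Rightarrow>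
   ('p mesh \<Rightarrow> 'p mesh \<Rightarrow> 'p mesh) \<Rightarrow> 'p mesh \<Rightarrow> ('p mesh \<Rightarrow> 'h set) \<Rightarrow> real \<Rightarrow> bool"
where
  "discretization smul b refine T0 X \<gamma>0 \<longleftrightarrow>
     (\<forall>TH\<in>refinements refine T0. \<exists>B. finite B \<and> X TH = module.span smul B) \<and>
     (\<forall>TH\<in>refinements refine T0. \<forall>Th\<in>refinements refine TH. X TH \<subseteq> X Th) \<and>
     0 < \<gamma>0 \<and> (\<forall>TH\<in>refinements refine T0. inf_sup_stable b (X TH) \<gamma>0) \<and>
     (\<forall>v. (INF TH\<in>refinements refine T0. infdist v (X TH)) = 0) \<and>
     (\<forall>TH\<in>refinements refine T0. \<forall>v. \<forall>\<epsilon>>0. \<exists>Th\<in>refinements refine TH.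
        TH \<inter> Th = {} \<and> infdist v (X Th) \<le> \<epsilon>)"

definition galerkin ::
  "('h \<Rightarrow> 'h \<Rightarrow> 'k) \<Rightarrow> ('h \<Rightarrow>\<^sub>L 'k::real_or_complex) \<Rightarrow> 'h set \<Rightarrow> 'h::banach"
where
  "galerkin b F X = (THE w. w \<in> X \<and> (\<forall>v\<in>X. b w v = blinfun_apply F v))"

text \<open>
  \<open>I TH\<close> and \<open>J TH\<close> index the degrees of freedom on \<open>TH\<close> and on its uniform refinement;
  \<open>JT TH T\<close> are those of the latter that correspond to the element \<open>T\<close>.  They enter only
  through the sums defining the estimator.
\<close>

definition dof_sets ::
  "('p mesh \<Rightarrow> 'p mesh \<Rightarrow> 'p mesh) \<Rightarrow> 'p mesh \<Rightarrow> ('p mesh \<Rightarrow> 'z set) \<Rightarrow> ('p mesh \<Rightarrow> 'z set) \<Rightarrow>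
   ('p mesh \<Rightarrow> 'p set \<Rightarrow> 'z set) \<Rightarrow> bool"
where
  "dof_sets refine T0 I J JT \<longleftrightarrow>
     (\<forall>TH\<in>refinements refine T0.
        finite (J TH) \<and> I TH \<subseteq> J TH \<and> (\<Union>T\<in>TH. JT TH T - I TH) = J TH - I TH)"

definition tau_elem ::
  "('p mesh \<Rightarrow> 'z set) \<Rightarrow> ('p mesh \<Rightarrow> 'p set \<Rightarrow> 'z set) \<Rightarrow> ('p mesh \<Rightarrow> 'z \<Rightarrow> real) \<Rightarrow>
   'p mesh \<Rightarrow> 'p set \<Rightarrow> real"
where
  "tau_elem I JT \<tau> TH T = sqrt (\<Sum>z\<in>JT TH T - I TH. (\<tau> TH z)\<^sup>2)"

definition tau_set ::
  "('p mesh \<Rightarrow> 'z set) \<Rightarrow> ('p mesh \<Rightarrow> 'p set \<Rightarrow> 'z set) \<Rightarrow> ('p mesh \<Rightarrow> 'z \<Rightarrow> real) \<Rightarrow>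
   'p mesh \<Rightarrow> 'p mesh \<Rightarrow> real"
where
  "tau_set I JT \<tau> TH U = sqrt (\<Sum>T\<in>U. (tau_elem I JT \<tau> TH T)\<^sup>2)"

text \<open>
  In the following, \<open>\<eta> TH U\<close> stands for the estimator \<^const>\<open>tau_set\<close> and \<open>g TH\<close> for the
  Galerkin solution on \<open>TH\<close>.
\<close>

definition discrete_efficiency_reliability ::
  "('p mesh \<Rightarrow> 'p mesh \<Rightarrow> 'p mesh) \<Rightarrow> 'p mesh \<Rightarrow> ('p mesh \<Rightarrow> 'p mesh \<Rightarrow> real) \<Rightarrow>
   ('p mesh \<Rightarrow> 'h::banach) \<Rightarrow> real \<Rightarrow> bool"
where
  "discrete_efficiency_reliability refine T0 \<eta> g Cest \<longleftrightarrow>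
     (\<forall>TH\<in>refinements refine T0. \<forall>MH. MH \<subseteq> TH \<longrightarrow>
        (let Th = refine TH MH in
           inverse Cest * \<eta> TH MH \<le> norm (g Th - g TH) \<and>
           norm (g Th - g TH) \<le> Cest * \<eta> TH (TH - Th)))"

definition stability ::
  "('p mesh \<Rightarrow> 'p mesh \<Rightarrow> 'p mesh) \<Rightarrow> 'p mesh \<Rightarrow> ('p mesh \<Rightarrow> 'p mesh \<Rightarrow> real) \<Rightarrow>
   ('p mesh \<Rightarrow> 'h::banach) \<Rightarrow> real \<Rightarrow> bool"
where
  "stability refine T0 \<eta> g Cstab \<longleftrightarrow>
     (\<forall>TH\<in>refinements refine T0. \<forall>Th\<in>refinements refine TH.
        \<bar>\<eta> Th (TH \<inter> Th) - \<eta> TH (TH \<inter> Th)\<bar> \<le> Cstab * norm (g Th - g TH))"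

definition doerfler :: "('p mesh \<Rightarrow> 'p mesh \<Rightarrow> real) \<Rightarrow> real \<Rightarrow> 'p mesh \<Rightarrow> 'p mesh \<Rightarrow> bool"
where
  "doerfler \<eta> \<theta> TH U \<longleftrightarrow> U \<subseteq> TH \<and> \<theta> * (\<eta> TH TH)\<^sup>2 \<le> (\<eta> TH U)\<^sup>2"

definition adaptive_output ::
  "('p mesh \<Rightarrow> 'p mesh \<Rightarrow> 'p mesh) \<Rightarrow> 'p mesh \<Rightarrow> ('p mesh \<Rightarrow> 'p mesh \<Rightarrow> real) \<Rightarrow>
   real \<Rightarrow> real \<Rightarrow> (nat \<Rightarrow> 'p mesh) \<Rightarrow> bool"
where
  "adaptive_output refine T0 \<eta> \<theta> Cmark T \<longleftrightarrow>
     T 0 = T0 \<and>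
     (\<forall>l. \<exists>M. doerfler \<eta> \<theta> (T l) M \<and>
        real (card M) \<le> Cmark * real (Min (card ` {U. doerfler \<eta> \<theta> (T l) U})) \<and>
        T (Suc l) = refine (T l) M)"

definition strong_saturation ::
  "('p mesh \<Rightarrow> 'p mesh \<Rightarrow> 'p mesh) \<Rightarrow> ('p mesh \<Rightarrow> 'h::banach) \<Rightarrow> 'h \<Rightarrow> (nat \<Rightarrow> 'p mesh) \<Rightarrow>
   real \<Rightarrow> real \<Rightarrow> bool"
where
  "strong_saturation refine g u T \<kappa> q \<longleftrightarrow>
     (\<forall>l. \<forall>Th\<in>refinements refine (T l).
        let TH = refine (T l) (T l - Th) in
          norm (u - g Th) \<le> \<kappa> * norm (u - g (T l)) \<longrightarrow>
          norm (u - g TH) \<le> q * norm (u - g (T l)))"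

definition linear_convergence_index ::
  "('p mesh \<Rightarrow> 'h::banach) \<Rightarrow> 'h \<Rightarrow> (nat \<Rightarrow> 'p mesh) \<Rightarrow> nat \<Rightarrow> bool"
where
  "linear_convergence_index g u T l0 \<longleftrightarrow>
     (\<exists>q. 0 < q \<and> q < 1 \<and>
        (\<forall>l\<ge>l0. norm (u - g (T (Suc l))) \<le> q * norm (u - g (T l))))"

text \<open>The infima are minima: the mesh sets are finite and the spaces finite-dimensional.\<close>

definition approx_const ::
  "('p mesh \<Rightarrow> 'p mesh \<Rightarrow> 'p mesh) \<Rightarrow> 'p mesh \<Rightarrow> ('p mesh \<Rightarrow> 'h::banach set) \<Rightarrow> 'h \<Rightarrow>
   real \<Rightarrow> ennreal"
where
  "approx_const refine T0 X u s =
     (SUP N::nat. INF T\<in>{T\<in>refinements refine T0. int (card T) - int (card T0) \<le> int N}.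
        INF v\<in>X T. ennreal ((real N + 1) powr s * norm (u - v)))"

end

theory Submission
  imports Defs
begin

text \<open>
Write \<open>e\<^sub>l\<close> for the error \<open>\<parallel>u - u\<^sub>l\<parallel>\<close>. The rate is optimal because of two facts: the errors decay
linearly, and each set of marked elements is, up to the factor \<open>Cmark\<close>, no larger than the number of
elements by which any mesh that allows a fixed fraction of \<open>e\<^sub>l\<close> as error exceeds \<open>T0\<close>.

The discrete efficiency and reliability, together with saturation for the uniform refinement,
make \<open>e\<^sub>l\<close> equivalent to the estimator (\<open>error_le_estimator\<close>, \<open>estimator_le_error\<close>) and turn the
marking criterion into \<open>c e\<^sub>l \<le> \<parallel>u\<^sub>l\<^sub>+\<^sub>1 - u\<^sub>l\<parallel>\<close> (\<open>increment_lower_bound\<close>). The delicate point is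
to deduce linear convergence with a rate that depends neither on \<open>u\<close> nor on the sequence of
meshes: the contraction factor in the definition of the index \<open>l0\<close> may be arbitrarily close to 1,
yet \<open>Copt\<close> must not depend on it. An argument based on the compactness of \<open>K\<close> only gives a
contraction from some index on that depends on the solution. The uniform rate comes instead from
inf-sup stability and the parallelogram law. If the errors stayed comparable on \<open>2\<^sup>D\<close> consecutive
levels, their means over two neighbouring dyadic blocks of levels would be close to each other
for large \<open>D\<close> (\<open>close_dyadic_means\<close>). But the first mean differs from \<open>u\<close> by an element of a
discrete space, and the second is annihilated by \<open>b\<close> on the next larger one. By stability, their
distance therefore bounds the Galerkin increment between the two spaces
(\<open>increment_le_separation\<close>), which is at least \<open>c\<close> times the error. Hence the error is halved after a number of steps that depends
on \<open>c\<close> and the stability constants only (\<open>error_halved\<close>).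

The existence of \<open>l0\<close> does use compactness. The same device of dyadic means shows that \<open>K\<close> maps
the normalized increments to a null sequence (\<open>K_annihilated_tendsto_0\<close>). Consequently the
increments are asymptotically orthogonal to the subsequent errors, and an approximate Pythagoras
identity gives the contraction (\<open>eventually_contractive\<close>).

For the upper bound, a mesh \<open>T'\<close> that realizes the approximation class is overlaid with \<open>T l\<close>.
Strong saturation shows that the elements refined in the overlay satisfy the marking criterion if
\<open>\<theta>\<close> is small, and counting sons shows that there are at most \<open>card T' - card T0\<close> of them
(\<open>card_marked_le\<close>). The closure estimate bounds \<open>card (T l)\<close> by the sum of all marked elements,
which by linear convergence is a geometric sum dominated by its last term (\<open>upper_bound\<close>). For the
lower bound it suffices that consecutive meshes have comparable cardinality (\<open>lower_bound\<close>).
\<close>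

section \<open>Hilbert space geometry\<close>

lemma norm_kcnj: "norm (kcnj a) = norm (a :: 'k::real_or_complex)"
proof (cases "a = 0")
  case True
  then show ?thesis
    using kcnj_scaleR_1[of 0, where 'a = 'k] by simp
next
  case False
  have "norm a * norm (kcnj a) = (norm a)\<^sup>2"
    by (simp add: mult_kcnj norm_mult[symmetric])
  with False show ?thesis by (simp add: power2_eq_square)
qed

context hilbert_space
begin

lemma ip_add_right: "ip x (y + z) = ip x y + ip x z"
  by (metis ip_add_left ip_commute kcnj_add)

lemma ip_scale_right: "ip x (smul a y) = kcnj a * ip x y"
  by (metis ip_scale_left ip_commute kcnj_mult)

lemma norm_ip_commute: "norm (ip y x) = norm (ip x y)"
  by (metis ip_commute norm_kcnj)

lemma ip_scaleR_left: "ip (r *\<^sub>R x) y = of_real r * ip x y"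
  by (metis ip_scale_left scale_of_real)

lemma ip_scaleR_right: "ip x (r *\<^sub>R y) = of_real r * ip x y"
  by (metis ip_scale_right scale_of_real kcnj_scaleR_1 of_real_def)

lemma ip_add_self: "of_real ((norm (x + y))\<^sup>2) = of_real ((norm x)\<^sup>2 + (norm y)\<^sup>2) + (ip x y + ip y x)"
proof -
  have "ip (x + y) (x + y) = ip x x + ip x y + (ip y x + ip y y)"
    by (simp add: ip_add_left ip_add_right)
  then show ?thesis by (simp add: ip_self)
qed

lemma parallelogram:
  fixes x y :: 'h
  shows "(norm (x + y))\<^sup>2 + (norm (x - y))\<^sup>2 = 2 * (norm x)\<^sup>2 + 2 * (norm y)\<^sup>2"
proof -
  have "ip x (- y) = - ip x y" "ip (- y) x = - ip y x"
    using ip_scaleR_left[of "-1" y x] ip_scaleR_right[of x "-1" y] by simp_all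
  then have "of_real ((norm (x - y))\<^sup>2)
      = of_real ((norm x)\<^sup>2 + (norm y)\<^sup>2) - (ip x y + ip y x)"
    using ip_add_self[of x "- y"] by simp
  with ip_add_self[of x y]
  have "of_real ((norm (x + y))\<^sup>2 + (norm (x - y))\<^sup>2)
      = (of_real (2 * (norm x)\<^sup>2 + 2 * (norm y)\<^sup>2) :: 'k)"
    by simp
  then show ?thesis by (simp only: of_real_eq_iff)
qed

text \<open>
The form in which an approximate Pythagoras identity is needed: the mixed term is only known to
be small, not to vanish.
\<close>

lemma norm_add_ge:
  "(norm x)\<^sup>2 + (norm y)\<^sup>2 - 2 * norm (ip x y) \<le> (norm (x + y))\<^sup>2"
proof -
  have "of_real ((norm x)\<^sup>2 + (norm y)\<^sup>2 - (norm (x + y))\<^sup>2) = - (ip x y + ip y x)"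
    using ip_add_self[of x y] by simp
  then have "\<bar>(norm x)\<^sup>2 + (norm y)\<^sup>2 - (norm (x + y))\<^sup>2\<bar> = norm (ip x y + ip y x)"
    by (metis norm_minus_cancel norm_of_real)
  also have "\<dots> \<le> 2 * norm (ip x y)"
    using norm_triangle_ineq[of "ip x y" "ip y x"] by (simp add: norm_ip_commute)
  finally show ?thesis by linarith
qed

lemma norm_smul: "norm (smul a x) = norm a * norm x"
proof -
  have "of_real ((norm (smul a x))\<^sup>2) = a * kcnj a * of_real ((norm x)\<^sup>2)"
    by (metis ip_self ip_scale_left ip_scale_right mult.assoc)
  also have "\<dots> = of_real ((norm a * norm x)\<^sup>2)"
    by (simp add: mult_kcnj power_mult_distrib scaleR_conv_of_real)
  finally have "(norm (smul a x))\<^sup>2 = (norm a * norm x)\<^sup>2"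
    by (simp only: of_real_eq_iff)
  then show ?thesis by (simp add: power2_eq_iff_nonneg)
qed

lemma Cauchy_Schwarz: "norm (ip x y) \<le> norm x * norm y"
proof (cases "y = 0 \<or> ip x y = 0")
  case True
  then show ?thesis using ip_scaleR_right[of x 0 y] by auto
next
  case False
  define a where "a = ip x y"
  \<comment> \<open>\<open>x + z\<close> is the component of \<open>x\<close> orthogonal to \<open>y\<close>\<close>
  define r where "r = - (1 / (norm y)\<^sup>2)"
  define z where "z = r *\<^sub>R smul a y"
  have ny: "norm y > 0" and na: "norm a > 0" using False by (auto simp: a_def)
  have "ip x z = of_real r * (kcnj a * a)"
    by (simp add: z_def ip_scaleR_right ip_scale_right a_def)
  then have xz: "ip x z = of_real (r * (norm a)\<^sup>2)"
    by (simp add: mult.commute[of "kcnj a"] mult_kcnj scaleR_conv_of_real)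
  then have zx: "ip z x = of_real (r * (norm a)\<^sup>2)"
    by (metis ip_commute kcnj_scaleR_1 of_real_def)
  have "of_real ((norm (x + z))\<^sup>2) = (of_real ((norm x)\<^sup>2 + (norm z)\<^sup>2 + 2 * (r * (norm a)\<^sup>2)) :: 'k)"
    unfolding ip_add_self xz zx by simp
  then have "(norm (x + z))\<^sup>2 = (norm x)\<^sup>2 + (norm z)\<^sup>2 + 2 * (r * (norm a)\<^sup>2)"
    by (simp only: of_real_eq_iff)
  moreover have "(norm z)\<^sup>2 = - (r * (norm a)\<^sup>2)"
    using ny by (simp add: z_def norm_smul r_def power2_eq_square)
  ultimately have "(norm (x + z))\<^sup>2 = (norm x)\<^sup>2 + r * (norm a)\<^sup>2" by linarith
  moreover have "0 \<le> (norm (x + z))\<^sup>2" by simp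
  ultimately have "0 \<le> (norm x)\<^sup>2 + r * (norm a)\<^sup>2" by linarith
  then have "(norm a)\<^sup>2 \<le> (norm x * norm y)\<^sup>2"
    using ny by (simp add: r_def field_simps power_mult_distrib)
  then show ?thesis unfolding a_def by (rule power2_le_imp_le) simp
qed

end

section \<open>Dyadic means\<close>

text \<open>
The mean of \<open>x s, \<dots>, x (s + 2 ^ i - 1)\<close>, with the bisection of the block made explicit for the
induction in \<open>dyadic_mean_energy\<close>.
\<close>

fun dyadic_mean :: "(nat \<Rightarrow> 'a::real_vector) \<Rightarrow> nat \<Rightarrow> nat \<Rightarrow> 'a" where
  "dyadic_mean x 0 s = x s"
| "dyadic_mean x (Suc i) s = (1/2) *\<^sub>R (dyadic_mean x i s + dyadic_mean x i (s + 2 ^ i))"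

lemma dyadic_mean_in_convex:
  assumes "convex S" and "\<And>k. s \<le> k \<Longrightarrow> k < s + 2 ^ i \<Longrightarrow> x k \<in> S"
  shows "dyadic_mean x i s \<in> S"
  using assms(2)
proof (induction i arbitrary: s)
  case 0
  then show ?case by simp
next
  case (Suc i)
  have "dyadic_mean x i s \<in> S" "dyadic_mean x i (s + 2 ^ i) \<in> S"
    by (rule Suc.IH, rule Suc.prems, auto)+
  from convexD[OF assms(1) this, of "1/2" "1/2"] show ?case
    by (simp add: scaleR_add_right)
qed

context hilbert_space
begin

text \<open>
By the parallelogram law, averaging two vectors at distance \<open>\<delta>\<close> lowers the mean square norm by
\<open>\<delta>\<^sup>2 / 4\<close>. If the means of neighbouring blocks are that far apart on all scales, this gain adds up
over the scales.
\<close>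

lemma dyadic_mean_energy:
  fixes x :: "nat \<Rightarrow> 'h"
  assumes bnd: "\<And>k. k < n \<Longrightarrow> norm (x k) \<le> M" and "0 \<le> \<delta>"
    and far: "\<And>i s. s + 2 ^ Suc i \<le> n \<Longrightarrow>
        \<delta> \<le> norm (dyadic_mean x i s - dyadic_mean x i (s + 2 ^ i))"
    and "s + 2 ^ i \<le> n"
  shows "(norm (dyadic_mean x i s))\<^sup>2 \<le> M\<^sup>2 - real i * \<delta>\<^sup>2 / 4"
  using assms(4)
proof (induction i arbitrary: s)
  case 0
  then show ?case using bnd[of s] by (simp add: power_mono)
next
  case (Suc i)
  let ?x = "dyadic_mean x i s" and ?y = "dyadic_mean x i (s + 2 ^ i)"
  have "(norm (dyadic_mean x (Suc i) s))\<^sup>2 = (norm (?x + ?y))\<^sup>2 / 4"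
    by (simp add: power_divide)
  also have "\<dots> = ((norm ?x)\<^sup>2 + (norm ?y)\<^sup>2) / 2 - (norm (?x - ?y))\<^sup>2 / 4"
    using parallelogram[of ?x ?y] by argo
  also have "\<dots> \<le> M\<^sup>2 - real i * \<delta>\<^sup>2 / 4 - \<delta>\<^sup>2 / 4"
  proof -
    have "(norm ?x)\<^sup>2 \<le> M\<^sup>2 - real i * \<delta>\<^sup>2 / 4" "(norm ?y)\<^sup>2 \<le> M\<^sup>2 - real i * \<delta>\<^sup>2 / 4"
      using Suc.prems by (auto intro!: Suc.IH)
    moreover have "\<delta>\<^sup>2 \<le> (norm (?x - ?y))\<^sup>2"
      using far[OF Suc.prems] \<open>0 \<le> \<delta>\<close> by (rule power_mono)
    moreover have "(a + b) / 2 - e / 4 \<le> c - d / 4" if "a \<le> c" "b \<le> c" "d \<le> e" for a b c d e :: real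
      using that by argo
    ultimately show ?thesis by blast
  qed
  finally show ?case by (simp add: field_simps)
qed

text \<open>
As a square norm is not negative, the gain of \<open>dyadic_mean_energy\<close> can be collected only a
bounded number of times. This finite substitute for weak compactness (a bounded sequence has
convex combinations that converge in norm) provides uniform constants.
\<close>

lemma close_dyadic_means:
  fixes x :: "nat \<Rightarrow> 'h"
  assumes "\<And>k. k < 2 ^ D \<Longrightarrow> norm (x k) \<le> M" and "0 \<le> \<delta>" and "4 * M\<^sup>2 < real D * \<delta>\<^sup>2"
  shows "\<exists>i s. s + 2 ^ Suc i \<le> 2 ^ D \<and>
    norm (dyadic_mean x i s - dyadic_mean x i (s + 2 ^ i)) < \<delta>"
proof (rule ccontr)
  assume no: "\<not> ?thesis"
  have "\<delta> \<le> norm (dyadic_mean x i s - dyadic_mean x i (s + 2 ^ i))"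
    if "s + 2 ^ Suc i \<le> 2 ^ D" for i s
    using no that linorder_not_le by blast
  from dyadic_mean_energy[OF assms(1,2) this, of "2 ^ D" 0 D]
  have "(norm (dyadic_mean x D 0))\<^sup>2 \<le> M\<^sup>2 - real D * \<delta>\<^sup>2 / 4" by simp
  moreover have "0 \<le> (norm (dyadic_mean x D 0))\<^sup>2" by simp
  ultimately show False using assms(3) by linarith
qed

end

section \<open>Counting elements under refinement\<close>

context mesh_refinement
begin

abbreviation "\<R> \<equiv> refinements refine"

lemma refinements_trans:
  assumes "Th \<in> \<R> TH" "Tr \<in> \<R> Th"
  shows "Tr \<in> \<R> TH"
  using assms(2,1) by induction (auto intro: refinements.intros)

lemma refinements_once: "M \<subseteq> TH \<Longrightarrow> refine TH M \<in> \<R> TH"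
  by (blast intro: refinements.intros)

lemma refinements_chain:
  assumes "\<And>l. T (Suc l) \<in> \<R> (T l)" "i \<le> j"
  shows "T j \<in> \<R> (T i)"
  using assms(2)
proof (induction rule: dec_induct)
  case base
  then show ?case by (rule refinements_refl)
next
  case (step n)
  then show ?case using refinements_trans assms(1) by blast
qed

lemma union_of_descendants:
  assumes "son_estimate refine T0 Cson" "TH \<in> \<R> T0" "Th \<in> \<R> TH" "T \<in> TH"
  shows "T = \<Union>{T'\<in>Th. T' \<subseteq> T}"
  using assms(3)
proof induction
  case refinements_refl
  then show ?case using assms(4) by blast
next
  case (refinements_step Th M)
  have Th: "Th \<in> \<R> T0" using refinements_trans assms(2) refinements_step.hyps(1) by blast
  have son: "T' = \<Union>{T''\<in>refine Th M. T'' \<subseteq> T'}" if "T' \<in> Th" for T'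
    using assms(1) that refinements_step.hyps Th refinements.refinements_step[OF Th]
    unfolding son_estimate_def by blast
  have "T \<subseteq> \<Union>{T'\<in>refine Th M. T' \<subseteq> T}"
  proof
    fix x assume "x \<in> T"
    then obtain T' where "x \<in> T'" "T' \<in> Th" "T' \<subseteq> T" using refinements_step.IH by blast
    moreover then obtain T'' where "x \<in> T''" "T'' \<in> refine Th M" "T'' \<subseteq> T'" using son by blast
    ultimately show "x \<in> \<Union>{T'\<in>refine Th M. T' \<subseteq> T}" by blast
  qed
  then show ?case by blast
qed

text \<open>
An element of a mesh that survives to a later mesh cannot have been refined and recovered in
between: a proper descendant would have a descendant in the later mesh, which would lie in the
surviving element.
\<close>

lemma descendant_in_between:
  assumes son: "son_estimate refine T0 Cson"
    and TH: "TH \<in> \<R> T0" and Tm: "Tm \<in> \<R> TH" and Th: "Th \<in> \<R> Tm"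
  shows "TH \<inter> Th \<subseteq> Tm"
proof
  fix T assume T: "T \<in> TH \<inter> Th"
  have Tm0: "Tm \<in> \<R> T0" and Th0: "Th \<in> \<R> T0"
    using TH Tm Th refinements_trans by blast+
  have "T \<noteq> {}" using nonempty TH T by blast
  with union_of_descendants[OF son TH Tm, of T] T
  obtain T' where T': "T' \<in> Tm" "T' \<subseteq> T" by blast
  have "T' \<noteq> {}" using nonempty Tm0 T' by blast
  with union_of_descendants[OF son Tm0 Th, of T'] T'
  obtain T'' where T'': "T'' \<in> Th" "T'' \<subseteq> T'" by blast
  have "T = T''"
    using nonoverlapping[OF Th0 refinements_refl, of T T'' T''] T T' T'' by blast
  then have "T = T'" using T' T'' by auto
  then show "T \<in> Tm" using T' by simp
qed

text \<open>
Every element contains at least one element of the refined mesh, and at least two if it has been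
refined, since a single one would have to be the element itself.
\<close>

lemma card_refined_le:
  assumes son: "son_estimate refine T0 Cson"
    and TH: "TH \<in> \<R> T0" and Th: "Th \<in> \<R> TH"
  shows "card TH + card (TH - Th) \<le> card Th"
proof -
  define S where "S T = {T'\<in>Th. T' \<subseteq> T}" for T
  have fin: "finite TH" "finite Th" using finite_mesh TH Th refinements_trans by blast+
  then have finS: "finite (S T)" for T by (simp add: S_def)
  have eq: "T = \<Union>(S T)" if "T \<in> TH" for T
    using union_of_descendants[OF son TH Th that] by (simp add: S_def)
  have ne: "S T \<noteq> {}" if "T \<in> TH" for T
    using eq[OF that] nonempty[OF TH that] by blast
  have ge: "1 + (if T \<in> Th then 0 else 1) \<le> card (S T)" if "T \<in> TH" for T
  proof -
    have "card (S T) \<noteq> 0" using ne[OF that] finS by simp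
    moreover have "card (S T) \<noteq> 1" if "T \<notin> Th"
    proof
      assume "card (S T) = 1"
      then obtain T' where "S T = {T'}" by (auto simp: card_1_singleton_iff)
      then have "T = T'" using eq[OF \<open>T \<in> TH\<close>] by simp
      with \<open>S T = {T'}\<close> \<open>T \<notin> Th\<close> show False by (auto simp: S_def)
    qed
    ultimately show ?thesis by auto
  qed
  have "card TH + card (TH - Th) = (\<Sum>T\<in>TH. 1 + (if T \<in> Th then 0 else 1))"
    using fin by (subst sum.distrib) (simp add: sum.If_cases Diff_eq)
  also have "\<dots> \<le> (\<Sum>T\<in>TH. card (S T))" using ge by (rule sum_mono)
  also have "\<dots> = card (\<Union>T\<in>TH. S T)"
    using fin finS nonoverlapping[OF TH Th]
    by (intro card_UN_disjoint[symmetric]) (auto simp: S_def)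
  also have "\<dots> \<le> card Th" using fin by (intro card_mono) (auto simp: S_def)
  finally show ?thesis .
qed

end

section \<open>Uniformly stable Galerkin discretizations\<close>

context hilbert_space
begin

lemma compact_operator_scaleR:
  assumes "compact_operator smul K"
  shows "K (r *\<^sub>R x) = r *\<^sub>R K x"
proof (rule blinfun_eqI)
  fix v
  have "blinfun_apply (K (smul (of_real r) x)) v = of_real r * blinfun_apply (K x) v"
    using assms unfolding compact_operator_def by blast
  then show "blinfun_apply (K (r *\<^sub>R x)) v = blinfun_apply (r *\<^sub>R K x) v"
    by (simp add: scale_of_real scaleR_conv_of_real blinfun.scaleR_left)
qed

lemma compact_operator_bounded:
  assumes "compact_operator smul K"
  shows "\<exists>C\<ge>0. \<forall>x. norm (K x) \<le> C * norm x"
proof -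
  have "compact (closure (K ` cball 0 1))"
    using assms unfolding compact_operator_def by blast
  then have "bounded (K ` cball 0 1)"
    by (meson bounded_subset closure_subset compact_imp_bounded)
  then obtain C where "\<forall>x\<in>cball 0 1. norm (K x) \<le> C"
    unfolding bounded_iff by auto
  then have C: "norm (K x) \<le> C" if "norm x \<le> 1" for x using that by simp
  have "norm (K x) \<le> C * norm x" for x
  proof (cases "x = 0")
    case True
    then show ?thesis using compact_operator_scaleR[OF assms, of 0 x] by simp
  next
    case False
    then have "norm (K x) = norm (K ((1 / norm x) *\<^sub>R x)) * norm x"
      by (simp add: compact_operator_scaleR[OF assms])
    also have "\<dots> \<le> C * norm x" using False by (intro mult_right_mono C) auto
    finally show ?thesis .
  qed
  moreover have "0 \<le> C" by (rule order_trans[OF norm_ge_zero C[of 0]]) simp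
  ultimately show ?thesis by blast
qed

end

locale stable_discretization = hilbert_space smul ip + mesh_refinement refine T0
  for smul :: "'k::real_or_complex \<Rightarrow> 'h::banach \<Rightarrow> 'h"
    and ip :: "'h \<Rightarrow> 'h \<Rightarrow> 'k"
    and refine :: "'p mesh \<Rightarrow> 'p mesh \<Rightarrow> 'p mesh" and T0 +
  fixes K :: "'h \<Rightarrow> ('h \<Rightarrow>\<^sub>L 'k)" and X :: "'p mesh \<Rightarrow> 'h set" and \<gamma> CK :: real
  assumes compact_K: "compact_operator smul K"
    and CK_nonneg: "0 \<le> CK"
    and K_bound: "norm (K x) \<le> CK * norm x"
    and discretization: "discretization smul (bform ip K) refine T0 X \<gamma>"
begin

abbreviation "b \<equiv> bform ip K"

lemma K_add: "K (x + y) = K x + K y"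
  using compact_K by (simp add: compact_operator_def)

lemmas K_scaleR = compact_operator_scaleR[OF compact_K]

lemma b_add_left: "b (x + y) v = b x v + b y v"
  by (simp add: bform_def ip_add_left K_add blinfun.add_left)

lemma b_smul_left: "b (smul a x) v = a * b x v"
  using compact_K by (simp add: bform_def ip_scale_left compact_operator_def distrib_left)

lemma b_scaleR_left: "b (r *\<^sub>R x) v = of_real r * b x v"
  by (metis b_smul_left scale_of_real)

lemma b_diff_left: "b (x - y) v = b x v - b y v"
  using b_add_left[of "x - y" y v] by simp

lemma b_add_right: "b x (v + w) = b x v + b x w"
  by (simp add: bform_def ip_add_right blinfun.add_right)

lemma b_smul_right: "b x (smul a v) = kcnj a * b x v"
  using compact_K
  by (simp add: bform_def ip_scale_right compact_operator_def dual_space_def distrib_left)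

lemma norm_b_le: "norm (b x v) \<le> (1 + CK) * norm x * norm v"
proof -
  have "norm (b x v) \<le> norm (ip x v) + norm (blinfun_apply (K x) v)"
    unfolding bform_def by (rule norm_triangle_ineq)
  also have "norm (blinfun_apply (K x) v) \<le> norm (K x) * norm v"
    by (rule norm_blinfun)
  also have "\<dots> \<le> CK * norm x * norm v" by (intro mult_right_mono K_bound) simp
  finally show ?thesis using Cauchy_Schwarz[of x v] by (simp add: algebra_simps)
qed

lemma convex_annihilator: "convex {x. \<forall>v\<in>S. b x v = 0}"
  by (auto simp: convex_def b_add_left b_scaleR_left)

lemma X_span:
  assumes "TH \<in> \<R> T0"
  obtains B where "finite B" "X TH = span B"
  using discretization[unfolded discretization_def, THEN conjunct1, rule_format, OF assms] that
  by blast

lemma subspace_X: "TH \<in> \<R> T0 \<Longrightarrow> subspace (X TH)"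
  by (metis X_span subspace_span)

lemma X_mono: "TH \<in> \<R> T0 \<Longrightarrow> Th \<in> \<R> TH \<Longrightarrow> X TH \<subseteq> X Th"
  using discretization[unfolded discretization_def, THEN conjunct2, THEN conjunct1] by simp

lemma \<gamma>_pos: "0 < \<gamma>"
  using discretization by (simp add: discretization_def)

lemma X_diff: "TH \<in> \<R> T0 \<Longrightarrow> x \<in> X TH \<Longrightarrow> y \<in> X TH \<Longrightarrow> x - y \<in> X TH"
  by (metis subspace_X subspace_diff)

lemma X_scaleR: "TH \<in> \<R> T0 \<Longrightarrow> x \<in> X TH \<Longrightarrow> r *\<^sub>R x \<in> X TH"
  by (metis subspace_X subspace_scale scale_of_real)

lemma convex_X: "TH \<in> \<R> T0 \<Longrightarrow> convex (X TH)"
  by (auto simp: convex_def intro!: subspace_add subspace_X X_scaleR)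

lemma convex_errors: "TH \<in> \<R> T0 \<Longrightarrow> convex {x. u - x \<in> X TH}"
proof -
  assume TH: "TH \<in> \<R> T0"
  have "u - (s *\<^sub>R x + t *\<^sub>R y) = s *\<^sub>R (u - x) + t *\<^sub>R (u - y)" if "s + t = 1" for s t :: real and x y
    using that by (simp add: algebra_simps flip: scaleR_add_left)
  then show ?thesis
    using TH by (auto simp: convex_def intro!: subspace_add subspace_X X_scaleR)
qed

text \<open>
The inf-sup condition as an a priori bound, which covers \<open>w = 0\<close> and the trivial space.
\<close>

lemma inf_sup_bound:
  assumes "TH \<in> \<R> T0" "w \<in> X TH" "0 \<le> c" "\<And>v. v \<in> X TH \<Longrightarrow> norm (b w v) \<le> c * norm v"
  shows "\<gamma> * norm w \<le> c"
proof (cases "w = 0")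
  case True
  then show ?thesis using assms by simp
next
  case False
  have "ennreal \<gamma> \<le> (INF w\<in>X TH - {0}. SUP v\<in>X TH - {0}. ennreal (norm (b w v) / (norm w * norm v)))"
    using discretization assms(1) by (simp add: discretization_def inf_sup_stable_def)
  also have "\<dots> \<le> (SUP v\<in>X TH - {0}. ennreal (norm (b w v) / (norm w * norm v)))"
    using False assms(2) by (intro INF_lower) simp
  also have "\<dots> \<le> ennreal (c / norm w)"
    using assms(4) False by (intro SUP_least ennreal_leI) (auto simp: field_simps)
  finally have "\<gamma> \<le> c / norm w" using assms(3) by (simp add: ennreal_le_iff)
  then show ?thesis using False by (simp add: field_simps)
qed

lemma inf_sup_zero:
  assumes "TH \<in> \<R> T0" "w \<in> X TH" "\<And>v. v \<in> X TH \<Longrightarrow> b w v = 0"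
  shows "w = 0"
proof -
  have "\<gamma> * norm w \<le> 0" using assms by (intro inf_sup_bound) auto
  then show ?thesis using \<gamma>_pos by (simp add: mult_le_0_iff)
qed

text \<open>
For a basis \<open>B\<close> of the discrete space, the linear map \<open>w \<mapsto> \<Sum>e\<in>B. b w e \<cdot> e\<close> encodes the Galerkin
matrix. The inf-sup condition makes it injective, so by counting dimensions it is onto, and a
preimage of \<open>\<Sum>e\<in>B. F e \<cdot> e\<close> solves the Galerkin equations.
\<close>

lemma galerkin_exists:
  assumes TH: "TH \<in> \<R> T0" and F: "F \<in> dual_space smul"
  shows "\<exists>w\<in>X TH. \<forall>v\<in>X TH. b w v = blinfun_apply F v"
proof -
  obtain B' where B': "finite B'" "X TH = span B'" using TH by (rule X_span)
  obtain B where B: "B \<subseteq> B'" "independent B" and "B' \<subseteq> span B"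
    using maximal_independent_subset[of B'] by blast
  then have "span B = span B'" using span_superset[of B'] by (auto simp: span_eq)
  have fin: "finite B" using B B' finite_subset by blast
  have XB: "X TH = span B" using B'(2) \<open>span B = span B'\<close> by simp
  define L where "L w = (\<Sum>e\<in>B. smul (b w e) e)" for w
  have "Vector_Spaces.linear smul smul L"
    by unfold_locales
      (auto simp: L_def b_add_left b_smul_left scale_left_distrib sum.distrib scale_sum_right)
  then interpret L: Vector_Spaces.linear smul smul L .
  have coeffs: "\<forall>e\<in>B. f e = h e"
    if "(\<Sum>e\<in>B. smul (f e) e) = (\<Sum>e\<in>B. smul (h e) e)" for f h
  proof -
    have "(\<Sum>e\<in>B. smul (f e - h e) e) = 0"
      using that by (simp add: scale_left_diff_distrib sum_subtractf)
    then show ?thesis using independentD[OF B(2) fin subset_refl, of "\<lambda>e. f e - h e"] by auto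
  qed
  have F_add: "blinfun_apply F (x + y) = blinfun_apply F x + blinfun_apply F y"
    and F_smul: "blinfun_apply F (smul a x) = kcnj a * blinfun_apply F x" for x y a
    using F by (simp_all add: blinfun.add_right dual_space_def)
  have on_span: "\<forall>v\<in>X TH. b w v = 0" if "\<forall>e\<in>B. b w e = 0" for w
  proof
    fix v assume "v \<in> X TH"
    then have "v \<in> span B" using XB by simp
    then show "b w v = 0"
    proof (induction rule: span_induct_alt)
      case base
      then show ?case using b_smul_right[of w 0 0] b_add_right[of w 0 0] by simp
    next
      case (step c x y)
      then show ?case using that by (simp add: b_add_right b_smul_right)
    qed
  qed
  have ker: "w = 0" if "w \<in> span B" "L w = 0" for w
  proof (rule inf_sup_zero[OF TH])
    show "w \<in> X TH" using that XB by simp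
    have "\<forall>e\<in>B. b w e = 0" using coeffs[of "b w" "\<lambda>_. 0"] that by (simp add: L_def)
    then show "b w v = 0" if "v \<in> X TH" for v using on_span that by blast
  qed
  have inj: "inj_on L (span B)"
  proof (rule inj_onI)
    fix x y assume xy: "x \<in> span B" "y \<in> span B" "L x = L y"
    have "x - y = 0" by (rule ker, insert xy) (auto simp: L.diff span_diff)
    then show "x = y" by simp
  qed
  have ind: "independent (L ` B)" by (rule L.independent_injective_image[OF B(2) inj])
  have cardLB: "card (L ` B) = card B"
    using inj_on_subset[OF inj span_superset] by (rule card_image)
  have in_span: "(\<Sum>e\<in>B. smul (f e) e) \<in> span B" for f
    by (rule span_sum, rule span_scale, rule span_base)
  then have "L ` B \<subseteq> span B" by (auto simp: L_def)
  have "e \<in> span (L ` B)" if "e \<in> B" for e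
  proof (rule ccontr)
    assume e: "e \<notin> span (L ` B)"
    then have "independent (insert e (L ` B))" using ind by (rule independent_insertI)
    moreover have "insert e (L ` B) \<subseteq> span B"
      using \<open>L ` B \<subseteq> span B\<close> span_base[OF that] by simp
    ultimately have "card (insert e (L ` B)) \<le> card B"
      using independent_span_bound[OF fin] by simp
    moreover have "e \<notin> L ` B" using e span_base by auto
    ultimately show False using fin cardLB by simp
  qed
  then have "span B \<subseteq> span (L ` B)" by (intro span_minimal subspace_span) auto
  then have surj: "span B \<subseteq> L ` span B" by (simp add: L.span_image)
  obtain w where w: "w \<in> span B" "L w = (\<Sum>e\<in>B. smul (blinfun_apply F e) e)"
    using surj in_span[of "blinfun_apply F"] by force
  have wB: "\<forall>e\<in>B. b w e = blinfun_apply F e" using w(2) unfolding L_def by (rule coeffs)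
  have "b w v = blinfun_apply F v" if "v \<in> span B" for v
    using that
  proof (induction rule: span_induct_alt)
    case base
    then show ?case using b_add_right[of w 0 0] by (simp add: blinfun.zero_right)
  next
    case (step c x y)
    then show ?case using wB by (simp add: b_add_right b_smul_right F_add F_smul)
  qed
  then show ?thesis using w XB by blast
qed

lemma galerkin_solves:
  assumes TH: "TH \<in> \<R> T0" and F: "F \<in> dual_space smul"
  shows "galerkin b F (X TH) \<in> X TH"
    and "v \<in> X TH \<Longrightarrow> b (galerkin b F (X TH)) v = blinfun_apply F v"
proof -
  have "\<exists>!w. w \<in> X TH \<and> (\<forall>v\<in>X TH. b w v = blinfun_apply F v)"
  proof (rule ex_ex1I)
    show "\<exists>w. w \<in> X TH \<and> (\<forall>v\<in>X TH. b w v = blinfun_apply F v)"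
      using galerkin_exists[OF assms] by blast
  next
    fix w w' assume *: "w \<in> X TH \<and> (\<forall>v\<in>X TH. b w v = blinfun_apply F v)"
      "w' \<in> X TH \<and> (\<forall>v\<in>X TH. b w' v = blinfun_apply F v)"
    have "w - w' = 0" by (rule inf_sup_zero[OF TH]) (insert TH *, auto simp: b_diff_left X_diff)
    then show "w = w'" by simp
  qed
  from theI'[OF this] show "galerkin b F (X TH) \<in> X TH"
    and "v \<in> X TH \<Longrightarrow> b (galerkin b F (X TH)) v = blinfun_apply F v"
    unfolding galerkin_def by blast+
qed

text \<open>
The constant of Cea's lemma (\<open>quasi_optimal\<close> below): 1 plus the ratio of the continuity and the
inf-sup constants.
\<close>

definition cea :: real where "cea = 1 + (1 + CK) / \<gamma>"

lemma cea_ge_1: "1 \<le> cea"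
  using \<gamma>_pos CK_nonneg by (simp add: cea_def)

lemma discrete_bound:
  assumes "TH \<in> \<R> T0" "w \<in> X TH" "\<And>v. v \<in> X TH \<Longrightarrow> b w v = b x v"
  shows "norm w \<le> (cea - 1) * norm x"
proof -
  have "\<gamma> * norm w \<le> (1 + CK) * norm x"
    using assms norm_b_le[of x] CK_nonneg by (intro inf_sup_bound) auto
  then show ?thesis using \<gamma>_pos by (simp add: cea_def field_simps)
qed

text \<open>
The assumptions are those satisfied by normalized Galerkin increments, with \<open>w k\<close> in the discrete
space of level \<open>k + 1\<close> and annihilated by \<open>b\<close> on that of level \<open>k\<close>. If the images did not tend
to 0, compactness would yield a subsequence whose images cluster at some \<open>y \<noteq> 0\<close>, so that dyadic
means along it could not be small. For neighbouring blocks \<open>A\<close>, \<open>B\<close> of it, the space at the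
beginning of \<open>B\<close> contains the mean \<open>?A\<close> and is annihilated by \<open>?B\<close>. Stability then bounds \<open>?A\<close>
by \<open>?A - ?B\<close>, and \<open>close_dyadic_means\<close> makes the latter small.
\<close>

lemma K_annihilated_tendsto_0:
  assumes T: "\<And>k. T k \<in> \<R> T0" "\<And>k. T (Suc k) \<in> \<R> (T k)"
    and w: "\<And>k. w k \<in> X (T (Suc k))" "\<And>k. norm (w k) \<le> 1"
    and ann: "\<And>k v. v \<in> X (T k) \<Longrightarrow> b (w k) v = 0"
  shows "(\<lambda>k. K (w k)) \<longlonglongrightarrow> 0"
proof (rule ccontr)
  assume "\<not> ?thesis"
  then obtain \<epsilon> where \<epsilon>: "\<epsilon> > 0" "\<not> (\<exists>N. \<forall>n\<ge>N. norm (K (w n)) < \<epsilon>)"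
    unfolding LIMSEQ_iff by auto
  have "infinite {n. \<epsilon> \<le> norm (K (w n))}"
    unfolding infinite_nat_iff_unbounded_le using \<epsilon>(2) by (meson linorder_not_less mem_Collect_eq)
  then obtain r :: "nat \<Rightarrow> nat" where r: "strict_mono r" "\<And>n. \<epsilon> \<le> norm (K (w (r n)))"
    using infinite_enumerate by (metis mem_Collect_eq)
  have "compact (closure (K ` cball 0 1))"
    using compact_K unfolding compact_operator_def by blast
  moreover have "K (w (r n)) \<in> closure (K ` cball 0 1)" for n
    using w(2) closure_subset by (metis image_subset_iff mem_cball_0 subsetD imageI)
  ultimately obtain y r' where r': "strict_mono (r' :: nat \<Rightarrow> nat)"
    and y: "((\<lambda>n. K (w (r n))) \<circ> r') \<longlonglongrightarrow> y"
    unfolding compact_def by (metis (no_types, lifting))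
  obtain n0 where n0: "\<And>n. n \<ge> n0 \<Longrightarrow> dist (K (w (r (r' n)))) y < \<epsilon> / 4"
    using y \<epsilon>(1) unfolding lim_sequentially comp_def
    by (metis divide_pos_pos zero_less_numeral)
  \<comment> \<open>the subsequence, with the terms dropped whose images are not yet close to \<open>y\<close>\<close>
  define p where "p n = r (r' (n + n0))" for n
  have p: "strict_mono p"
    using r(1) r' by (auto simp: strict_mono_def p_def)
  define x where "x = w \<circ> p"
  have close: "K (x n) \<in> cball y (\<epsilon> / 4)" for n
    using n0[of "n + n0"] by (simp add: x_def p_def dist_commute)
  have ny: "3 * \<epsilon> / 4 \<le> norm y"
  proof -
    have "\<epsilon> \<le> norm (K (x 0))" using r(2) by (simp add: x_def p_def)
    moreover have "norm (K (x 0)) \<le> norm y + dist y (K (x 0))"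
      by (metis dist_commute dist_norm norm_triangle_sub)
    ultimately show ?thesis using close[of 0] by simp
  qed
  have nested: "X (T i) \<subseteq> X (T j)" if "i \<le> j" for i j
    using lift_Suc_mono_le[of "\<lambda>k. X (T k)", OF X_mono[OF T] that] .
  have Kmean: "\<epsilon> / 2 \<le> CK * norm (dyadic_mean x i s)" for i s
  proof -
    have "convex {z. K z \<in> cball y (\<epsilon> / 4)}"
      using convex_cball[of y "\<epsilon> / 4"] by (auto simp: convex_def K_add K_scaleR)
    then have "dyadic_mean x i s \<in> {z. K z \<in> cball y (\<epsilon> / 4)}"
      by (rule dyadic_mean_in_convex) (use close in auto)
    then have "norm y \<le> norm (K (dyadic_mean x i s)) + \<epsilon> / 4"
      using norm_triangle_sub[of y "K (dyadic_mean x i s)"] by (simp add: dist_norm)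
    with ny K_bound[of "dyadic_mean x i s"] show ?thesis by linarith
  qed
  have CK: "0 < CK"
    using Kmean[of 0 0] \<epsilon>(1) CK_nonneg by (cases "CK = 0") auto
  have far: "\<epsilon> / 2 / CK \<le> (cea - 1) * norm (dyadic_mean x i s - dyadic_mean x i (s + 2 ^ i))" for i s
  proof -
    let ?A = "dyadic_mean x i s" and ?B = "dyadic_mean x i (s + 2 ^ i)"
    let ?m = "p (s + 2 ^ i)"
    have "?A \<in> X (T ?m)"
    proof (rule dyadic_mean_in_convex[OF convex_X[OF T(1)]])
      fix k assume "k < s + 2 ^ i"
      then have "Suc (p k) \<le> ?m" using p by (simp add: Suc_le_eq strict_mono_less)
      then show "x k \<in> X (T ?m)" using nested w(1) by (auto simp: x_def)
    qed
    moreover have "?B \<in> {z. \<forall>v\<in>X (T ?m). b z v = 0}"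
    proof (rule dyadic_mean_in_convex[OF convex_annihilator])
      fix k assume "s + 2 ^ i \<le> k"
      then have "?m \<le> p k" using p by (simp add: strict_mono_less_eq)
      then show "x k \<in> {z. \<forall>v\<in>X (T ?m). b z v = 0}"
        using nested[OF \<open>?m \<le> p k\<close>] ann by (auto simp: x_def)
    qed
    ultimately have "norm ?A \<le> (cea - 1) * norm (?A - ?B)"
      by (intro discrete_bound[OF T(1)]) (auto simp: b_diff_left)
    moreover have "\<epsilon> / 2 / CK \<le> norm ?A" using Kmean[of i s] CK by (simp add: field_simps)
    ultimately show ?thesis by linarith
  qed
  define \<delta> where "\<delta> = \<epsilon> / 2 / CK / cea"
  have \<delta>: "0 < \<delta>" using CK \<epsilon>(1) cea_ge_1 by (simp add: \<delta>_def)
  obtain D :: nat where "4 / \<delta>\<^sup>2 < real D" using reals_Archimedean2 by blast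
  then have "4 * 1\<^sup>2 < real D * \<delta>\<^sup>2" using \<delta> by (simp add: field_simps)
  moreover have "norm (x k) \<le> 1" for k using w(2) by (simp add: x_def)
  ultimately obtain i s where *: "norm (dyadic_mean x i s - dyadic_mean x i (s + 2 ^ i)) < \<delta>"
    using close_dyadic_means[of D x 1 \<delta>] \<delta> by auto
  have "\<epsilon> / 2 / CK \<le> cea * norm (dyadic_mean x i s - dyadic_mean x i (s + 2 ^ i))"
    using far[of i s] by (rule order_trans) (simp add: mult_right_mono)
  also have "\<dots> < cea * \<delta>" using * cea_ge_1 by simp
  also have "\<dots> = \<epsilon> / 2 / CK" using cea_ge_1 by (simp add: \<delta>_def)
  finally show False by simp
qed

end

section \<open>Convergence of Galerkin solutions along nested spaces\<close>

locale galerkin_solution = stable_discretization smul ip refine T0 K X \<gamma> CK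
  for smul :: "'k::real_or_complex \<Rightarrow> 'h::banach \<Rightarrow> 'h"
    and ip :: "'h \<Rightarrow> 'h \<Rightarrow> 'k"
    and refine :: "'p mesh \<Rightarrow> 'p mesh \<Rightarrow> 'p mesh" and T0 K X \<gamma> CK +
  fixes F :: "'h \<Rightarrow>\<^sub>L 'k" and u :: 'h
  assumes F_dual: "F \<in> dual_space smul"
    and solves: "b u v = blinfun_apply F v"
begin

abbreviation "gal TH \<equiv> galerkin b F (X TH)"

definition err :: "'p mesh \<Rightarrow> real" where "err TH = norm (u - gal TH)"

lemmas gal_in = galerkin_solves(1)[OF _ F_dual]

lemma err_nonneg: "0 \<le> err TH"
  by (simp add: err_def)

lemma orthogonality: "TH \<in> \<R> T0 \<Longrightarrow> v \<in> X TH \<Longrightarrow> b (u - gal TH) v = 0"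
  using galerkin_solves(2)[OF _ F_dual] by (simp add: b_diff_left solves)

lemma quasi_optimal:
  assumes "TH \<in> \<R> T0" "v \<in> X TH"
  shows "err TH \<le> cea * norm (u - v)"
proof -
  have "b (gal TH - v) w = b (u - v) w" if "w \<in> X TH" for w
    using orthogonality[OF assms(1) that] by (simp add: b_diff_left)
  then have "norm (gal TH - v) \<le> (cea - 1) * norm (u - v)"
    using gal_in[OF assms(1)] assms(2) by (intro discrete_bound[OF assms(1)] X_diff[OF assms(1)])
  moreover have "err TH \<le> norm (u - v) + norm (gal TH - v)"
    unfolding err_def using norm_triangle_ineq4[of "u - v" "gal TH - v"] by simp
  ultimately show ?thesis by (simp add: left_diff_distrib)
qed

lemma quasi_monotone: "TH \<in> \<R> T0 \<Longrightarrow> Th \<in> \<R> TH \<Longrightarrow> err Th \<le> cea * err TH"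
  unfolding err_def[of TH] using refinements_trans X_mono gal_in
  by (intro quasi_optimal) blast+

lemma increment_le_error:
  assumes "TH \<in> \<R> T0" "Th \<in> \<R> TH"
  shows "norm (gal Th - gal TH) \<le> (1 + cea) * err TH"
proof -
  have "norm (gal Th - gal TH) \<le> err Th + err TH"
    unfolding err_def using norm_triangle_ineq4[of "u - gal TH" "u - gal Th"] by simp
  with quasi_monotone[OF assms] show ?thesis by (simp add: distrib_right)
qed

text \<open>
Both Galerkin solutions are compared with the discrete function \<open>u - x\<close>: on the finer space, the
residual of \<open>gal Th - (u - x)\<close> is that of \<open>x\<close>, hence that of \<open>x - y\<close>, and on the coarser space
\<open>gal TH\<close> is the Galerkin projection of \<open>gal Th\<close>. Errors of coarser and of finer Galerkin solutions,
and convex combinations of these, are examples of \<open>x\<close> and \<open>y\<close>.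
\<close>

lemma increment_le_separation:
  assumes TH: "TH \<in> \<R> T0" and Th: "Th \<in> \<R> TH"
    and x: "u - x \<in> X TH" and y: "\<And>v. v \<in> X Th \<Longrightarrow> b y v = 0"
  shows "norm (gal Th - gal TH) \<le> cea\<^sup>2 * norm (x - y)"
proof -
  have Th0: "Th \<in> \<R> T0" using refinements_trans TH Th by blast
  have sub: "X TH \<subseteq> X Th" by (rule X_mono[OF TH Th])
  define w w' where "w = gal Th - (u - x)" and "w' = gal TH - (u - x)"
  have "b w v = b (x - y) v" if "v \<in> X Th" for v
    using orthogonality[OF Th0 that] y[OF that] by (simp add: w_def b_diff_left)
  moreover have "w \<in> X Th" using gal_in[OF Th0] x sub Th0 by (auto simp: w_def intro: X_diff)
  ultimately have w: "norm w \<le> (cea - 1) * norm (x - y)" by (intro discrete_bound[OF Th0])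
  have "b w' v = b w v" if "v \<in> X TH" for v
    using orthogonality[OF TH that] orthogonality[OF Th0, of v] that sub
    by (auto simp: w_def w'_def b_diff_left)
  moreover have "w' \<in> X TH" using gal_in[OF TH] x TH by (auto simp: w'_def intro: X_diff)
  ultimately have w': "norm w' \<le> (cea - 1) * norm w" by (intro discrete_bound[OF TH])
  have "gal Th - gal TH = w - w'" by (simp add: w_def w'_def)
  then have "norm (gal Th - gal TH) \<le> norm w + norm w'" using norm_triangle_ineq4 by simp
  also have "\<dots> \<le> cea * norm w" using w' by (simp add: left_diff_distrib)
  also have "\<dots> \<le> cea * (cea * norm (x - y))"
  proof (intro mult_left_mono)
    show "norm w \<le> cea * norm (x - y)"
      using w by (rule order_trans) (simp add: mult_right_mono)
  qed (use cea_ge_1 in simp)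
  finally show ?thesis by (simp add: power2_eq_square mult.assoc)
qed

end

context stable_discretization
begin

text \<open>
A power of 2 because the levels are grouped in dyadic blocks. The exponent is large enough to be a
\<open>D\<close> with \<open>4 M\<^sup>2 < D \<delta>\<^sup>2\<close> for \<open>M = cea * e\<close> and \<open>\<delta> = c * e / (2 * cea ^ 3)\<close>, where \<open>e\<close>
is the error at the first level.
\<close>

definition halving_steps :: "real \<Rightarrow> nat" where
  "halving_steps c = 2 ^ (nat \<lceil>16 * cea ^ 8 / c\<^sup>2\<rceil> + 1)"

definition rate :: "real \<Rightarrow> real" where
  "rate c = (1/2) powr (1 / real (halving_steps c))"

lemma halving_steps_pos: "0 < halving_steps c"
  by (simp add: halving_steps_def)

lemma rate_pos: "0 < rate c"
  by (simp add: rate_def)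

lemma rate_less_1: "rate c < 1"
proof -
  have "(1/2::real) powr (1 / real (halving_steps c)) < 1 powr (1 / real (halving_steps c))"
    using halving_steps_pos[of c] by (intro powr_less_mono2) auto
  then show ?thesis by (simp add: rate_def)
qed

lemma rate_power_halving_steps: "rate c ^ halving_steps c = 1/2"
  using halving_steps_pos[of c]
  by (simp add: rate_def powr_realpow[symmetric] powr_powr)

end

text \<open>
All that the convergence analysis uses of the choice of the meshes is that each increment is at
least a fixed fraction of the error.
\<close>

locale galerkin_sequence = galerkin_solution smul ip refine T0 K X \<gamma> CK F u
  for smul :: "'k::real_or_complex \<Rightarrow> 'h::banach \<Rightarrow> 'h"
    and ip :: "'h \<Rightarrow> 'h \<Rightarrow> 'k"
    and refine :: "'p mesh \<Rightarrow> 'p mesh \<Rightarrow> 'p mesh" and T0 K X \<gamma> CK F u +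
  fixes T :: "nat \<Rightarrow> 'p mesh" and c :: real
  assumes T_0: "T 0 = T0"
    and T_Suc: "T (Suc l) \<in> \<R> (T l)"
    and c_pos: "0 < c"
    and increment_ge_error: "c * err (T l) \<le> norm (gal (T (Suc l)) - gal (T l))"
begin

lemma T_mono: "i \<le> j \<Longrightarrow> T j \<in> \<R> (T i)"
  by (rule refinements_chain[of T, OF T_Suc])

lemma T_in: "T l \<in> \<R> T0"
  using T_mono[of 0 l] by (simp add: T_0)

lemma err_quasi_monotone: "i \<le> j \<Longrightarrow> err (T j) \<le> cea * err (T i)"
  by (intro quasi_monotone T_in T_mono)

text \<open>
If the error were not halved, then by quasi-monotonicity all errors on the intermediate levels
would be at least \<open>err (T l) / (2 * cea)\<close>, and so would the increments, up to the factor \<open>c\<close>.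
This contradicts \<open>increment_le_separation\<close>, applied to the means of the errors over two
neighbouring dyadic blocks whose distance is small by \<open>close_dyadic_means\<close>.
\<close>

lemma error_halved: "err (T (l + halving_steps c)) \<le> err (T l) / 2"
proof (rule ccontr)
  assume neg: "\<not> ?thesis"
  define D where "D = nat \<lceil>16 * cea ^ 8 / c\<^sup>2\<rceil> + 1"
  have steps: "halving_steps c = 2 ^ D" by (simp add: halving_steps_def D_def)
  have cea: "0 < cea" using cea_ge_1 by simp
  have big: "err (T l) / (2 * cea) \<le> err (T (l + k))" if "k < 2 ^ D" for k
  proof -
    have "err (T l) / 2 \<le> err (T (l + 2 ^ D))" using neg steps by simp
    also have "\<dots> \<le> cea * err (T (l + k))" using that by (intro err_quasi_monotone) simp
    finally show ?thesis using cea by (simp add: field_simps)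
  qed
  have pos: "0 < err (T l)"
    using neg err_quasi_monotone[of l "l + halving_steps c"] err_nonneg[of "T l"] by (cases "err (T l) = 0") auto
  define x where "x k = u - gal (T (l + k))" for k
  define \<delta> where "\<delta> = c * err (T l) / (2 * cea ^ 3)"
  have \<delta>: "0 < \<delta>" using c_pos pos cea by (simp add: \<delta>_def)
  have "16 * cea ^ 8 / c\<^sup>2 < real D" unfolding D_def by linarith
  then have "16 * cea ^ 8 < real D * c\<^sup>2" using c_pos by (simp add: field_simps)
  then have "16 * cea ^ 8 * ((err (T l))\<^sup>2 / (4 * cea ^ 6)) < real D * c\<^sup>2 * ((err (T l))\<^sup>2 / (4 * cea ^ 6))"
    using pos cea by (intro mult_strict_right_mono) auto
  moreover have "16 * cea ^ 8 * ((err (T l))\<^sup>2 / (4 * cea ^ 6)) = 4 * (cea * err (T l))\<^sup>2"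
    using cea by (simp add: field_simps flip: power_add)
  moreover have "real D * c\<^sup>2 * ((err (T l))\<^sup>2 / (4 * cea ^ 6)) = real D * \<delta>\<^sup>2"
    by (simp add: \<delta>_def power_mult_distrib power_divide flip: power_mult)
  ultimately have "4 * (cea * err (T l))\<^sup>2 < real D * \<delta>\<^sup>2" by simp
  moreover have "norm (x k) \<le> cea * err (T l)" for k
    unfolding x_def using err_quasi_monotone[of l "l + k"] by (simp add: err_def)
  ultimately obtain i s where s: "s + 2 ^ Suc i \<le> 2 ^ D"
    and close: "norm (dyadic_mean x i s - dyadic_mean x i (s + 2 ^ i)) < \<delta>"
    using close_dyadic_means[of D x "cea * err (T l)" \<delta>] \<delta> by auto
  \<comment> \<open>the last level of the first block; the increment from it leads to the first level of the second\<close>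
  define k where "k = s + 2 ^ i - 1"
  have "(0::nat) < 2 ^ i" "s + 2 ^ i + 2 ^ i \<le> 2 ^ D" using s by simp_all
  then have k: "Suc k = s + 2 ^ i" "k < 2 ^ D" unfolding k_def by linarith+
  let ?A = "dyadic_mean x i s" and ?B = "dyadic_mean x i (s + 2 ^ i)"
  have "?A \<in> {z. u - z \<in> X (T (l + k))}"
  proof (rule dyadic_mean_in_convex[OF convex_errors[OF T_in]])
    fix j assume "j < s + 2 ^ i"
    then have "X (T (l + j)) \<subseteq> X (T (l + k))" using k(1) by (intro X_mono T_in T_mono) simp
    then show "x j \<in> {z. u - z \<in> X (T (l + k))}" using gal_in[OF T_in] by (auto simp: x_def)
  qed
  moreover have "?B \<in> {z. \<forall>v\<in>X (T (Suc (l + k))). b z v = 0}"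
  proof (rule dyadic_mean_in_convex[OF convex_annihilator])
    fix j assume "s + 2 ^ i \<le> j"
    then have "X (T (Suc (l + k))) \<subseteq> X (T (l + j))" using k(1) by (intro X_mono T_in T_mono) simp
    then show "x j \<in> {z. \<forall>v\<in>X (T (Suc (l + k))). b z v = 0}"
      using orthogonality[OF T_in] by (auto simp: x_def)
  qed
  ultimately have "norm (gal (T (Suc (l + k))) - gal (T (l + k))) \<le> cea\<^sup>2 * norm (?A - ?B)"
    by (intro increment_le_separation T_in T_Suc) auto
  also have "\<dots> < cea\<^sup>2 * \<delta>" using close cea by simp
  also have "\<dots> = c * (err (T l) / (2 * cea))"
    using cea by (simp add: \<delta>_def field_simps power2_eq_square power3_eq_cube)
  also have "\<dots> \<le> c * err (T (l + k))" using big[OF k(2)] c_pos by (intro mult_left_mono) auto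
  finally show False using increment_ge_error[of "l + k"] by simp
qed

lemma linear_convergence: "err (T (l + n)) \<le> 2 * cea * rate c ^ n * err (T l)"
proof -
  let ?N = "halving_steps c"
  have mult: "err (T (l + a * ?N)) \<le> (1/2) ^ a * err (T l)" for a
  proof (induction a)
    case (Suc a)
    have "err (T (l + Suc a * ?N)) = err (T ((l + a * ?N) + ?N))" by (simp add: algebra_simps)
    also have "\<dots> \<le> err (T (l + a * ?N)) / 2" by (rule error_halved)
    also have "\<dots> \<le> (1/2) ^ a * err (T l) / 2" using Suc.IH by simp
    finally show ?case by simp
  qed simp
  define a r where "a = n div ?N" and "r = n mod ?N"
  have n: "n = a * ?N + r" by (simp add: a_def r_def)
  have "r < ?N" using halving_steps_pos by (simp add: r_def)
  then have r: "1/2 \<le> rate c ^ r"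
    using power_decreasing[of r ?N "rate c"] rate_pos[of c] rate_less_1[of c]
    by (simp add: rate_power_halving_steps)
  have "rate c ^ n = (1/2) ^ a * rate c ^ r"
    unfolding n power_add by (simp add: mult.commute[of a] power_mult rate_power_halving_steps)
  with r have rn: "(1/2) ^ a \<le> 2 * rate c ^ n" by simp
  have "err (T (l + n)) \<le> cea * err (T (l + a * ?N))" by (rule err_quasi_monotone) (simp add: n)
  also have "\<dots> \<le> cea * ((1/2) ^ a * err (T l))"
    using mult[of a] cea_ge_1 by (intro mult_left_mono) auto
  also have "\<dots> \<le> cea * (2 * rate c ^ n * err (T l))"
    using rn cea_ge_1 err_nonneg by (intro mult_left_mono mult_right_mono) auto
  finally show ?thesis by (simp add: mult_ac)
qed

text \<open>
By linear convergence the summands grow geometrically, so the last error dominates the sum.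
\<close>

lemma sum_inverse_errors:
  assumes s: "0 < s" and pos: "0 < err (T l)"
  shows "(\<Sum>j<l. err (T j) powr (- 1 / s))
    \<le> (2 * cea) powr (1 / s) / (1 - rate c powr (1 / s)) * err (T l) powr (- 1 / s)"
proof -
  let ?\<sigma> = "rate c powr (1 / s)" and ?C = "(2 * cea) powr (1 / s)"
  have cea: "0 < cea" using cea_ge_1 by simp
  have \<sigma>: "0 < ?\<sigma>" "?\<sigma> < 1"
    using rate_pos[of c] rate_less_1[of c] s powr_less_mono2[of "1 / s" "rate c" 1] by auto
  have summand: "err (T j) powr (- 1 / s) \<le> ?C * ?\<sigma> ^ (l - j) * err (T l) powr (- 1 / s)" if "j < l" for j
  proof -
    have le: "err (T l) \<le> 2 * cea * rate c ^ (l - j) * err (T j)"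
      using linear_convergence[of j "l - j"] that by simp
    have ej: "0 < err (T j)"
      using pos err_quasi_monotone[of j l] that err_nonneg[of "T j"] by (cases "err (T j) = 0") auto
    have "err (T l) powr (1 / s) \<le> (2 * cea * rate c ^ (l - j) * err (T j)) powr (1 / s)"
      using le s pos by (intro powr_mono2) auto
    also have "\<dots> = ?C * ?\<sigma> ^ (l - j) * err (T j) powr (1 / s)"
      using cea rate_pos[of c] ej by (simp add: powr_mult powr_power powr_powr flip: powr_realpow)
    finally show ?thesis
      using pos ej by (simp add: powr_minus field_simps)
  qed
  have "(\<Sum>j<l. err (T j) powr (- 1 / s)) \<le> (\<Sum>j<l. ?C * ?\<sigma> ^ (l - j) * err (T l) powr (- 1 / s))"
    by (intro sum_mono summand) simp
  also have "\<dots> = ?C * (\<Sum>j<l. ?\<sigma> ^ (l - j)) * err (T l) powr (- 1 / s)"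
    by (simp add: sum_distrib_left sum_distrib_right)
  also have "(\<Sum>j<l. ?\<sigma> ^ (l - j)) = (\<Sum>j<l. ?\<sigma> ^ Suc j)"
    by (subst sum.nat_diff_reindex[symmetric]) (auto intro!: sum.cong simp: Suc_diff_Suc)
  also have "?C * (\<Sum>j<l. ?\<sigma> ^ Suc j) * err (T l) powr (- 1 / s)
      \<le> ?C * (1 / (1 - ?\<sigma>)) * err (T l) powr (- 1 / s)"
  proof (intro mult_right_mono mult_left_mono)
    have "(\<Sum>j<l. ?\<sigma> ^ Suc j) \<le> (\<Sum>j<l. ?\<sigma> ^ j)"
      using \<sigma> by (intro sum_mono power_decreasing) auto
    also have "\<dots> \<le> (\<Sum>j. ?\<sigma> ^ j)"
      using \<sigma> by (intro sum_le_suminf summable_geometric) auto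
    also have "\<dots> = 1 / (1 - ?\<sigma>)" using \<sigma> by (intro suminf_geometric) auto
    finally show "(\<Sum>j<l. ?\<sigma> ^ Suc j) \<le> 1 / (1 - ?\<sigma>)" .
  qed (use cea in auto)
  finally show ?thesis by simp
qed

lemma err_tendsto_0: "(\<lambda>n. err (T n)) \<longlonglongrightarrow> 0"
proof (rule tendsto_sandwich[of "\<lambda>_. 0"])
  show "(\<lambda>n. 2 * cea * rate c ^ n * err (T 0)) \<longlonglongrightarrow> 0"
    using rate_pos[of c] rate_less_1[of c]
    by (intro tendsto_mult_left_zero tendsto_mult_right_zero LIMSEQ_power_zero) auto
qed (use linear_convergence[of 0] err_nonneg in \<open>auto intro!: always_eventually\<close>)

text \<open>
The error is the sum of all later increments, which are summable with a bound proportional to the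
current error by linear convergence; \<open>K\<close> is small on each increment.
\<close>

lemma K_error_small:
  assumes "0 < \<epsilon>"
  shows "\<forall>\<^sub>F l in sequentially. norm (K (u - gal (T (Suc l)))) \<le> \<epsilon> * err (T l)"
proof -
  define d where "d k = gal (T (Suc k)) - gal (T k)" for k
  define w where "w k = (1 / norm (d k)) *\<^sub>R d k" for k
  define C where "C = 1 + (1 + cea) * (2 * cea / (1 - rate c))"
  have cea: "1 \<le> cea" by (rule cea_ge_1)
  have rate: "0 < rate c" "rate c < 1" by (rule rate_pos rate_less_1)+
  have C: "0 < C" unfolding C_def using cea rate by (intro add_pos_nonneg mult_nonneg_nonneg divide_nonneg_nonneg) auto
  have d_in: "d k \<in> X (T (Suc k))" for k
    unfolding d_def using gal_in[OF T_in] X_mono[OF T_in T_Suc] by (intro X_diff T_in) blast+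
  have "(\<lambda>k. K (w k)) \<longlonglongrightarrow> 0"
  proof (rule K_annihilated_tendsto_0[of T w, OF T_in T_Suc])
    show "w k \<in> X (T (Suc k))" for k unfolding w_def by (intro X_scaleR T_in d_in)
    show "norm (w k) \<le> 1" for k by (simp add: w_def)
    fix k v assume "v \<in> X (T k)"
    moreover from this have "v \<in> X (T (Suc k))" using X_mono[OF T_in T_Suc] by blast
    ultimately have "b (d k) v = 0"
      using orthogonality[OF T_in, of v k] orthogonality[OF T_in, of v "Suc k"]
      by (simp add: d_def b_diff_left)
    then show "b (w k) v = 0" by (simp add: w_def b_scaleR_left)
  qed
  then have "(\<lambda>k. norm (K (w k))) \<longlonglongrightarrow> 0" by (rule tendsto_norm_zero)
  then have "\<forall>\<^sub>F k in sequentially. norm (K (w k)) < \<epsilon> / C"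
    by (rule order_tendstoD(2)) (simp add: \<open>0 < \<epsilon>\<close> C)
  then obtain l0 where l0: "\<And>k. k \<ge> l0 \<Longrightarrow> norm (K (w k)) < \<epsilon> / C"
    by (auto simp: eventually_sequentially)
  then have Kd: "norm (K (d k)) \<le> \<epsilon> / C * norm (d k)" if "k \<ge> l0" for k
  proof (cases "d k = 0")
    case True
    then show ?thesis using K_bound[of 0] by simp
  next
    case False
    then have "norm (K (d k)) = norm (K (w k)) * norm (d k)" by (simp add: w_def K_scaleR)
    then show ?thesis using mult_right_mono[OF less_imp_le[OF l0[OF that]], of "norm (d k)"] by simp
  qed
  have "norm (K (u - gal (T (Suc l)))) \<le> \<epsilon> * err (T l)" if l: "l \<ge> l0" for l
  proof (cases "err (T l) = 0")
    case True
    then have "err (T (Suc l)) = 0" using err_quasi_monotone[of l "Suc l"] err_nonneg[of "T (Suc l)"] by simp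
    then show ?thesis using True K_bound[of "u - gal (T (Suc l))"] by (simp add: err_def)
  next
    case False
    then have pos: "0 < err (T l)" using err_nonneg[of "T l"] by simp
    have "(\<lambda>n. CK * err (T n)) \<longlonglongrightarrow> 0" by (intro tendsto_mult_right_zero err_tendsto_0)
    then have "\<forall>\<^sub>F n in sequentially. CK * err (T n) < \<epsilon> / C * err (T l)"
      by (rule order_tendstoD(2)) (simp add: \<open>0 < \<epsilon>\<close> C pos)
    then obtain n0 where "\<And>n. n \<ge> n0 \<Longrightarrow> CK * err (T n) < \<epsilon> / C * err (T l)"
      unfolding eventually_sequentially by blast
    then obtain n where n: "n \<ge> Suc l" "CK * err (T n) < \<epsilon> / C * err (T l)"
      using max.cobounded1 max.cobounded2 by blast
    \<comment> \<open>cutting the series off at \<open>n\<close> costs at most the share \<open>\<epsilon> / C\<close>, the summand 1 in \<open>C\<close>\<close>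
    have tele: "u - gal (T (Suc l)) = (u - gal (T n)) + (\<Sum>k=Suc l..<n. d k)"
      using sum_Suc_diff'[OF n(1), of "\<lambda>k. gal (T k)"] by (simp add: d_def)
    have Ksum: "K (sum d S) = (\<Sum>k\<in>S. K (d k))" for S
      by (induction S rule: infinite_finite_induct) (auto simp: K_add K_scaleR[of 0 0, simplified])
    have dk: "norm (d k) \<le> (1 + cea) * (2 * cea * rate c ^ (k - l) * err (T l))" if "l \<le> k" for k
    proof -
      have "norm (d k) \<le> (1 + cea) * err (T k)"
        unfolding d_def by (intro increment_le_error T_in T_Suc)
      also have "\<dots> \<le> (1 + cea) * (2 * cea * rate c ^ (k - l) * err (T l))"
        using linear_convergence[of l "k - l"] that cea by (intro mult_left_mono) auto
      finally show ?thesis .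
    qed
    have "(\<Sum>k=Suc l..<n. norm (d k)) \<le> (\<Sum>k=l..<n. norm (d k))"
      by (intro sum_mono2) auto
    also have "\<dots> \<le> (\<Sum>k=l..<n. (1 + cea) * (2 * cea * rate c ^ (k - l) * err (T l)))"
      by (intro sum_mono dk) simp
    also have "\<dots> = (1 + cea) * (2 * cea * (\<Sum>k=l..<n. rate c ^ (k - l)) * err (T l))"
      by (simp add: sum_distrib_left sum_distrib_right)
    also have "(\<Sum>k=l..<n. rate c ^ (k - l)) = (\<Sum>k<n - l. rate c ^ k)"
      using sum.shift_bounds_nat_ivl[of "\<lambda>k. rate c ^ (k - l)" 0 l "n - l"] n(1)
      by (simp add: lessThan_atLeast0)
    also have "(1 + cea) * (2 * cea * (\<Sum>k<n - l. rate c ^ k) * err (T l))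
        \<le> (1 + cea) * (2 * cea * (1 / (1 - rate c)) * err (T l))"
    proof (intro mult_left_mono mult_right_mono)
      have "(\<Sum>k<n - l. rate c ^ k) \<le> (\<Sum>k. rate c ^ k)"
        using rate by (intro sum_le_suminf summable_geometric) auto
      then show "(\<Sum>k<n - l. rate c ^ k) \<le> 1 / (1 - rate c)"
        using rate by (simp add: suminf_geometric)
    qed (use cea err_nonneg in auto)
    also have "\<dots> = (C - 1) * err (T l)" by (simp add: C_def)
    finally have sum_d: "(\<Sum>k=Suc l..<n. norm (d k)) \<le> (C - 1) * err (T l)" .
    have "norm (K (u - gal (T (Suc l)))) \<le> norm (K (u - gal (T n))) + (\<Sum>k=Suc l..<n. norm (K (d k)))"
      unfolding tele K_add Ksum by (intro norm_triangle_le add_left_mono norm_sum)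
    also have "\<dots> \<le> \<epsilon> / C * err (T l) + (\<Sum>k=Suc l..<n. \<epsilon> / C * norm (d k))"
      using n(2) K_bound[of "u - gal (T n)"] l by (intro add_mono sum_mono Kd) (auto simp: err_def)
    also have "\<dots> \<le> \<epsilon> / C * err (T l) + \<epsilon> / C * ((C - 1) * err (T l))"
      unfolding sum_distrib_left[symmetric] using sum_d \<open>0 < \<epsilon>\<close> C
      by (intro add_left_mono mult_left_mono) auto
    also have "\<dots> = \<epsilon> * err (T l)" using C by (simp add: field_simps)
    finally show ?thesis .
  qed
  then show ?thesis by (auto simp: eventually_sequentially)
qed

text \<open>
The new error \<open>?E\<close> and the increment \<open>?d\<close> add up to the old error. Galerkin orthogonality turns
their inner product into \<open>- K ?E ?d\<close>, which is eventually small relative to the squared error,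
whereas the square of the increment is a fixed fraction of it.
\<close>

lemma eventually_contractive: "\<exists>l0. linear_convergence_index gal u T l0"
proof -
  define \<epsilon> where "\<epsilon> = c\<^sup>2 / (4 * (1 + cea))"
  \<comment> \<open>the maximum keeps \<open>q\<close> real and positive without an upper bound for \<open>c\<close>\<close>
  define q where "q = sqrt (max (1/4) (1 - c\<^sup>2 / 2))"
  have cea: "1 \<le> cea" by (rule cea_ge_1)
  have "0 < \<epsilon>" using c_pos cea by (simp add: \<epsilon>_def)
  then obtain l0 where l0: "\<And>l. l \<ge> l0 \<Longrightarrow> norm (K (u - gal (T (Suc l)))) \<le> \<epsilon> * err (T l)"
    using K_error_small unfolding eventually_sequentially by blast
  have q: "0 < q" "q < 1" using c_pos by (auto simp: q_def)
  have q2: "1 - c\<^sup>2 / 2 \<le> q\<^sup>2" by (simp add: q_def)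
  have "err (T (Suc l)) \<le> q * err (T l)" if l: "l \<ge> l0" for l
  proof (rule power2_le_imp_le)
    let ?E = "u - gal (T (Suc l))" and ?d = "gal (T (Suc l)) - gal (T l)"
    have d_in: "?d \<in> X (T (Suc l))"
      using gal_in[OF T_in] X_mono[OF T_in T_Suc] by (intro X_diff T_in) blast+
    have "ip ?E ?d = - blinfun_apply (K ?E) ?d"
      using orthogonality[OF T_in d_in] by (simp add: bform_def eq_neg_iff_add_eq_0)
    then have "norm (ip ?E ?d) \<le> norm (K ?E) * norm ?d"
      using norm_blinfun[of "K ?E" ?d] by simp
    also have "\<dots> \<le> (\<epsilon> * err (T l)) * ((1 + cea) * err (T l))"
      using l0[OF l] increment_le_error[OF T_in T_Suc, of l] by (intro mult_mono) (auto simp: err_nonneg \<open>0 < \<epsilon>\<close> less_imp_le)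
    also have "\<dots> = c\<^sup>2 / 4 * (err (T l))\<^sup>2"
      using cea by (simp add: \<epsilon>_def power2_eq_square field_simps)
    finally have ip: "norm (ip ?E ?d) \<le> c\<^sup>2 / 4 * (err (T l))\<^sup>2" .
    have "(c * err (T l))\<^sup>2 \<le> (norm ?d)\<^sup>2"
      using increment_ge_error[of l] c_pos err_nonneg by (intro power_mono) auto
    then have "c\<^sup>2 * (err (T l))\<^sup>2 \<le> (norm ?d)\<^sup>2" by (simp add: power_mult_distrib)
    moreover have "(norm ?E)\<^sup>2 + (norm ?d)\<^sup>2 - 2 * norm (ip ?E ?d) \<le> (err (T l))\<^sup>2"
      using norm_add_ge[of ?E ?d] by (simp add: err_def)
    ultimately have "(err (T (Suc l)))\<^sup>2 \<le> (1 - c\<^sup>2 / 2) * (err (T l))\<^sup>2"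
      using ip by (simp add: err_def left_diff_distrib)
    also have "\<dots> \<le> q\<^sup>2 * (err (T l))\<^sup>2" using q2 by (intro mult_right_mono) auto
    finally show "(err (T (Suc l)))\<^sup>2 \<le> (q * err (T l))\<^sup>2" by (simp add: power_mult_distrib)
  qed (use q err_nonneg in auto)
  then show ?thesis using q unfolding linear_convergence_index_def err_def by blast
qed

end

section \<open>Optimality of the adaptive algorithm\<close>

lemma powr_neg_inverse_powr:
  fixes x s :: real
  assumes "0 < s" "0 < x"
  shows "(x powr (- 1 / s)) powr s = 1 / x"
  unfolding powr_powr using assms by (simp add: powr_minus_divide)

context stable_discretization
begin

text \<open>
The constants of the theorem: the fraction of the error that an increment attains, the bound for
\<open>\<theta>\<close> (the squared inverse of the product of the constants in \<open>error_le_estimator\<close> and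
\<open>estimator_le_error\<close>), the constant of
\<open>sum_inverse_errors\<close>, and that of the upper bound. None of them involves \<open>F\<close>, \<open>u\<close> or the sequence
of meshes.
\<close>

definition increment_const :: "real \<Rightarrow> real \<Rightarrow> real \<Rightarrow> real" where
  "increment_const Cest \<theta> q = sqrt \<theta> * (1 - q) / Cest\<^sup>2"

definition theta_bound :: "real \<Rightarrow> real \<Rightarrow> real" where
  "theta_bound Cest q = ((1 - q) / (Cest * (Cest * (1 + cea))))\<^sup>2"

definition sum_const :: "real \<Rightarrow> real \<Rightarrow> real \<Rightarrow> real \<Rightarrow> real" where
  "sum_const Cest \<theta> s q =
    (2 * cea) powr (1 / s) / (1 - rate (increment_const Cest \<theta> q) powr (1 / s))"

definition upper_const :: "real \<Rightarrow> real \<Rightarrow> real \<Rightarrow> real \<Rightarrow> real \<Rightarrow> real \<Rightarrow> real \<Rightarrow> real" where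
  "upper_const Cmesh Cest Cmark \<theta> s \<kappa> q =
    ((real (card T0) + 1) * (1 + Cmesh * Cmark * sum_const Cest \<theta> s q)) powr s * (2 * cea / \<kappa>)"

end

text \<open>
A run of the adaptive algorithm, for an abstract estimator \<open>\<eta>\<close>: besides discrete efficiency and
reliability, the arguments rest on its being nonnegative, monotone and zero on the empty set,
whatever the local indicators are.
\<close>

locale adaptive_run = galerkin_solution smul ip refine T0 K X \<gamma> CK F u
  for smul :: "'k::real_or_complex \<Rightarrow> 'h::banach \<Rightarrow> 'h"
    and ip :: "'h \<Rightarrow> 'h \<Rightarrow> 'k"
    and refine :: "'p mesh \<Rightarrow> 'p mesh \<Rightarrow> 'p mesh" and T0 K X \<gamma> CK F u +
  fixes \<eta> :: "'p mesh \<Rightarrow> 'p mesh \<Rightarrow> real" and Cson Cmesh Cest Cmark \<kappa> q \<theta> :: real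
    and T M :: "nat \<Rightarrow> 'p mesh"
  assumes son: "son_estimate refine T0 Cson"
    and overlay: "overlay_estimate refine T0"
    and closure: "closure_estimate refine T0 Cmesh"
    and \<eta>_nonneg: "0 \<le> \<eta> TH U"
    and \<eta>_empty: "\<eta> TH {} = 0"
    and \<eta>_mono: "TH \<in> refinements refine T0 \<Longrightarrow> U \<subseteq> V \<Longrightarrow> V \<subseteq> TH \<Longrightarrow> \<eta> TH U \<le> \<eta> TH V"
    and efficiency_reliability:
      "discrete_efficiency_reliability refine T0 \<eta> (\<lambda>TH. galerkin (bform ip K) F (X TH)) Cest"
    and Cest: "0 < Cest"
    and Cmark: "1 \<le> Cmark"
    and T_0: "T 0 = T0"
    and T_refine: "T (Suc l) = refine (T l) (M l)"
    and marked: "doerfler \<eta> \<theta> (T l) (M l)"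
    and quasi_minimal: "real (card (M l)) \<le> Cmark * real (Min (card ` {U. doerfler \<eta> \<theta> (T l) U}))"
    and saturation: "strong_saturation refine (\<lambda>TH. galerkin (bform ip K) F (X TH)) u T \<kappa> q"
    and \<kappa>: "0 < \<kappa>" "\<kappa> \<le> q" and q: "q < 1"
    and \<theta>: "0 < \<theta>" "\<theta> \<le> theta_bound Cest q"
begin

lemma efficiency:
  assumes "TH \<in> \<R> T0" "U \<subseteq> TH"
  shows "\<eta> TH U \<le> Cest * norm (gal (refine TH U) - gal TH)"
proof -
  have "inverse Cest * \<eta> TH U \<le> norm (gal (refine TH U) - gal TH)"
    using efficiency_reliability assms unfolding discrete_efficiency_reliability_def Let_def by simp
  then show ?thesis using Cest by (simp add: field_simps)
qed

lemma reliability: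
  assumes "TH \<in> \<R> T0" "U \<subseteq> TH"
  shows "norm (gal (refine TH U) - gal TH) \<le> Cest * \<eta> TH (TH - refine TH U)"
  using efficiency_reliability assms unfolding discrete_efficiency_reliability_def Let_def by simp

lemma estimator_le_error:
  assumes "TH \<in> \<R> T0"
  shows "\<eta> TH TH \<le> Cest * (1 + cea) * err TH"
proof -
  have "\<eta> TH TH \<le> Cest * norm (gal (refine TH TH) - gal TH)"
    by (intro efficiency assms) simp
  also have "\<dots> \<le> Cest * ((1 + cea) * err TH)"
    using Cest by (intro mult_left_mono increment_le_error assms refinements_once) auto
  finally show ?thesis by simp
qed

lemma M_subset: "M l \<subseteq> T l"
  using marked by (simp add: doerfler_def)

lemma T_mono: "i \<le> j \<Longrightarrow> T j \<in> \<R> (T i)"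
  by (rule refinements_chain[of T]) (simp_all add: T_refine refinements_once M_subset)

lemma T_in: "T l \<in> \<R> T0"
  using T_mono[of 0 l] by (simp add: T_0)

lemma finite_T: "finite (T l)"
  by (intro finite_mesh T_in)

text \<open>
Strong saturation replaces the arbitrary refinement \<open>Th\<close> by a one-step refinement \<open>TH\<close>, for which
discrete reliability is available. The elements refined in \<open>TH\<close> are also refined in \<open>Th\<close>, as \<open>TH\<close>
lies in between.
\<close>

lemma error_le_refined_estimator:
  assumes Th: "Th \<in> \<R> (T l)" and small: "err Th \<le> \<kappa> * err (T l)"
  shows "(1 - q) * err (T l) \<le> Cest * \<eta> (T l) (T l - Th)"
proof -
  define TH where "TH = refine (T l) (T l - Th)"
  have TH: "TH \<in> \<R> (T l)" unfolding TH_def by (intro refinements_once) auto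
  have "Th \<in> \<R> TH" unfolding TH_def using Th by (intro coarsest T_in) auto
  from descendant_in_between[OF son T_in TH this]
  have sub: "T l - TH \<subseteq> T l - Th" by blast
  have "err TH \<le> q * err (T l)"
    using saturation Th small unfolding strong_saturation_def Let_def TH_def err_def by simp
  moreover have "err (T l) \<le> err TH + norm (gal TH - gal (T l))"
    unfolding err_def using norm_triangle_ineq[of "u - gal TH" "gal TH - gal (T l)"] by simp
  ultimately have "(1 - q) * err (T l) \<le> norm (gal TH - gal (T l))"
    by (simp add: left_diff_distrib)
  also have "\<dots> \<le> Cest * \<eta> (T l) (T l - TH)"
    unfolding TH_def by (intro reliability T_in) auto
  also have "\<dots> \<le> Cest * \<eta> (T l) (T l - Th)"
    using Cest sub by (intro mult_left_mono \<eta>_mono T_in) auto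
  finally show ?thesis .
qed

text \<open>
The special case of \<open>error_le_refined_estimator\<close> for a refinement with sufficiently small error
that has no element in common with the current mesh.
\<close>

lemma error_le_estimator: "(1 - q) * err (T l) \<le> Cest * \<eta> (T l) (T l)"
proof (cases "err (T l) = 0")
  case True
  then show ?thesis using Cest \<eta>_nonneg by simp
next
  case False
  then have pos: "0 < err (T l)" using err_nonneg[of "T l"] by simp
  define \<epsilon> where "\<epsilon> = \<kappa> * err (T l) / (2 * cea)"
  have \<epsilon>: "0 < \<epsilon>" using pos \<kappa> cea_ge_1 by (simp add: \<epsilon>_def)
  have "\<forall>TH\<in>\<R> T0. \<forall>v. \<forall>\<epsilon>>0. \<exists>Th\<in>\<R> TH. TH \<inter> Th = {} \<and> infdist v (X Th) \<le> \<epsilon>"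
    using discretization by (simp add: discretization_def)
  then obtain Th where Th: "Th \<in> \<R> (T l)" "T l \<inter> Th = {}" "infdist u (X Th) \<le> \<epsilon>"
    using T_in \<epsilon> by blast
  have Th0: "Th \<in> \<R> T0" using T_in Th(1) refinements_trans by blast
  have "X Th \<noteq> {}" using gal_in[OF Th0] by blast
  moreover have "infdist u (X Th) < 2 * \<epsilon>" using Th(3) \<epsilon> by simp
  ultimately obtain v where v: "v \<in> X Th" "dist u v < 2 * \<epsilon>"
    by (auto simp: infdist_def cINF_less_iff)
  have "err Th \<le> cea * norm (u - v)" by (rule quasi_optimal[OF Th0 v(1)])
  also have "\<dots> \<le> cea * (2 * \<epsilon>)"
    using v(2) cea_ge_1 by (intro mult_left_mono) (auto simp: dist_norm)
  also have "\<dots> = \<kappa> * err (T l)" using cea_ge_1 by (simp add: \<epsilon>_def)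
  finally have "(1 - q) * err (T l) \<le> Cest * \<eta> (T l) (T l - Th)"
    by (rule error_le_refined_estimator[OF Th(1)])
  then show ?thesis using Th(2) by (simp add: Diff_triv)
qed

lemma increment_lower_bound:
  "increment_const Cest \<theta> q * err (T l) \<le> norm (gal (T (Suc l)) - gal (T l))"
proof -
  have "sqrt \<theta> * \<eta> (T l) (T l) \<le> \<eta> (T l) (M l)"
  proof (rule power2_le_imp_le)
    show "(sqrt \<theta> * \<eta> (T l) (T l))\<^sup>2 \<le> (\<eta> (T l) (M l))\<^sup>2"
      using marked[of l] \<theta>(1) by (simp add: doerfler_def power_mult_distrib)
  qed (rule \<eta>_nonneg)
  also have "\<dots> \<le> Cest * norm (gal (T (Suc l)) - gal (T l))"
    unfolding T_refine by (intro efficiency T_in M_subset)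
  finally have 1: "sqrt \<theta> * \<eta> (T l) (T l) \<le> Cest * norm (gal (T (Suc l)) - gal (T l))" .
  have "sqrt \<theta> * ((1 - q) * err (T l)) \<le> sqrt \<theta> * (Cest * \<eta> (T l) (T l))"
    using \<theta>(1) by (intro mult_left_mono error_le_estimator) auto
  also have "\<dots> = Cest * (sqrt \<theta> * \<eta> (T l) (T l))" by simp
  also have "\<dots> \<le> Cest * (Cest * norm (gal (T (Suc l)) - gal (T l)))"
    using 1 Cest by (intro mult_left_mono) auto
  finally show ?thesis
    using Cest by (simp add: increment_const_def field_simps power2_eq_square)
qed

sublocale galerkin_sequence smul ip refine T0 K X \<gamma> CK F u T "increment_const Cest \<theta> q"
proof
  show "0 < increment_const Cest \<theta> q"
    using \<theta>(1) q Cest by (simp add: increment_const_def)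
  show "increment_const Cest \<theta> q * err (T l) \<le> norm (gal (T (Suc l)) - gal (T l))" for l
    by (rule increment_lower_bound)
qed (simp_all add: T_0 T_refine refinements_once M_subset)

text \<open>
The elements refined in the overlay with \<open>T'\<close> satisfy the marking criterion, since \<open>\<theta>\<close> is small
compared with the constants relating estimator and error. Thus they compete with the marked set,
and their number is controlled by the overlay estimate.
\<close>

lemma card_marked_le:
  assumes T': "T' \<in> \<R> T0" and v: "v \<in> X T'" "cea * norm (u - v) \<le> \<kappa> * err (T l)"
  shows "real (card (M l)) \<le> Cmark * (real (card T') - real (card T0))"
proof -
  obtain Th where Th: "Th \<in> \<R> (T l)" "Th \<in> \<R> T'"
    and card: "int (card Th) \<le> int (card (T l)) + int (card T') - int (card T0)"
    using overlay T_in[of l] T' unfolding overlay_estimate_def by blast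
  have "v \<in> X Th" using v(1) X_mono[OF T' Th(2)] by blast
  then have "err Th \<le> \<kappa> * err (T l)"
    using quasi_optimal[of Th v] refinements_trans[OF T' Th(2)] v(2) by simp
  then have 1: "(1 - q) * err (T l) \<le> Cest * \<eta> (T l) (T l - Th)"
    by (rule error_le_refined_estimator[OF Th(1)])
  let ?t = "(1 - q) / (Cest * (Cest * (1 + cea)))"
  have cea: "0 < 1 + cea" using cea_ge_1 by simp
  have "?t * \<eta> (T l) (T l) \<le> ?t * (Cest * (1 + cea) * err (T l))"
    using q Cest cea by (intro mult_left_mono estimator_le_error T_in) auto
  also have "\<dots> = (1 - q) * err (T l) / Cest"
  proof -
    have "x / (C * (C * k)) * (C * k * e) = x * e / C" if "C \<noteq> 0" "k \<noteq> 0" for x C k e :: real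
      using that by (simp add: field_simps)
    then show ?thesis using Cest cea by simp
  qed
  also have "\<dots> \<le> \<eta> (T l) (T l - Th)" using 1 Cest by (simp add: field_simps)
  finally have "(?t * \<eta> (T l) (T l))\<^sup>2 \<le> (\<eta> (T l) (T l - Th))\<^sup>2"
    using q Cest cea \<eta>_nonneg by (intro power_mono) auto
  moreover have "\<theta> * (\<eta> (T l) (T l))\<^sup>2 \<le> (?t * \<eta> (T l) (T l))\<^sup>2"
    unfolding power_mult_distrib using \<theta>(2) by (intro mult_right_mono) (simp_all add: theta_bound_def)
  ultimately have "doerfler \<eta> \<theta> (T l) (T l - Th)" by (auto simp: doerfler_def)
  moreover have "finite {U. doerfler \<eta> \<theta> (T l) U}"
    by (rule finite_subset[of _ "Pow (T l)"]) (auto simp: doerfler_def finite_T)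
  ultimately have "Min (card ` {U. doerfler \<eta> \<theta> (T l) U}) \<le> card (T l - Th)"
    by (intro Min_le) auto
  moreover have "card (T l) + card (T l - Th) \<le> card Th"
    by (rule card_refined_le[OF son T_in Th(1)])
  ultimately have "real (Min (card ` {U. doerfler \<eta> \<theta> (T l) U})) \<le> real (card T') - real (card T0)"
    using card by linarith
  then have "Cmark * real (Min (card ` {U. doerfler \<eta> \<theta> (T l) U}))
      \<le> Cmark * (real (card T') - real (card T0))"
    using Cmark by (intro mult_left_mono) auto
  with quasi_minimal[of l] show ?thesis by linarith
qed

text \<open>
The strict bound \<open>d > a\<close> replaces the attainment of the infima.
\<close>

lemma near_best_mesh:
  assumes "approx_const refine T0 X u s = ennreal a" "a < d" "0 \<le> a"
  obtains T' v where "T' \<in> \<R> T0" "card T' \<le> card T0 + N" "v \<in> X T'"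
    "(real N + 1) powr s * norm (u - v) < d"
proof -
  let ?S = "{T\<in>\<R> T0. int (card T) - int (card T0) \<le> int N}"
  let ?f = "\<lambda>v. ennreal ((real N + 1) powr s * norm (u - v))"
  have "(INF T\<in>?S. INF v\<in>X T. ?f v) \<le> ennreal a"
    unfolding assms(1)[symmetric] approx_const_def by (rule SUP_upper) simp
  also have "\<dots> < ennreal d" using assms(2,3) by (simp add: ennreal_less_iff)
  finally obtain T' v where "T' \<in> ?S" "v \<in> X T'" "?f v < ennreal d"
    unfolding INF_less_iff by blast
  then show thesis using that by (auto simp: ennreal_less_iff)
qed

lemma unrefined_if_card_le:
  assumes "T' \<in> \<R> T0" "card T' \<le> card T0"
  shows "T' = T0"
proof -
  have fin: "finite T'" "finite T0" using assms(1) finite_mesh refinements_refl by blast+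
  have "card T0 + card (T0 - T') \<le> card T'"
    by (rule card_refined_le[OF son refinements_refl assms(1)])
  then have "card (T0 - T') = 0" using assms(2) by linarith
  then have "T0 - T' = {}" using fin by (simp only: card_0_eq finite_Diff)
  then show ?thesis using card_seteq[OF fin(1), of T0] assms(2) by blast
qed

text \<open>
The term \<open>N = 0\<close> of the approximation constant involves the initial mesh only.
\<close>

lemma error_le_approx_const:
  assumes "approx_const refine T0 X u s = ennreal a" "0 \<le> a"
  shows "err (T l) \<le> cea * a"
proof -
  have "err (T l) / cea \<le> a + e" if "0 < e" for e
  proof -
    have "a < a + e" using that by simp
    then obtain T' v where *: "T' \<in> \<R> T0" "card T' \<le> card T0 + 0" "v \<in> X T'"
      "(real 0 + 1) powr s * norm (u - v) < a + e"
      using near_best_mesh[OF assms(1) _ assms(2)] by metis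
    then have "T' = T0" by (intro unrefined_if_card_le) simp_all
    then have "v \<in> X T0" using *(3) by simp
    then have "v \<in> X (T l)" using X_mono[OF refinements_refl T_in] by blast
    then have "err (T l) \<le> cea * norm (u - v)" by (intro quasi_optimal T_in)
    then have "err (T l) / cea \<le> norm (u - v)" using cea_ge_1 by (simp add: field_simps)
    with *(4) show ?thesis by simp
  qed
  then have "err (T l) / cea \<le> a" by (rule field_le_epsilon)
  then show ?thesis using cea_ge_1 by (simp add: field_simps)
qed

text \<open>
The near-best mesh with \<open>N\<close> additional elements meets the error bound of \<open>card_marked_le\<close> as soon
as \<open>N + 1\<close> exceeds the claimed bound without \<open>Cmark\<close>, whose integer part is therefore chosen as
\<open>N\<close>; the factor 2 leaves room for near-best approximation.
\<close>

lemma card_marked_le_rate: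
  assumes s: "0 < s" and a: "approx_const refine T0 X u s = ennreal a" "0 < a"
    and pos: "0 < err (T l)"
  shows "real (card (M l)) \<le> Cmark * (2 * cea * a / \<kappa>) powr (1 / s) * err (T l) powr (- 1 / s)"
proof -
  define B where "B = 2 * cea * a / \<kappa>"
  define \<rho> where "\<rho> = B powr (1 / s) * err (T l) powr (- 1 / s)"
  define N where "N = nat \<lfloor>\<rho>\<rfloor>"
  have B: "0 < B" using cea_ge_1 a(2) \<kappa>(1) by (simp add: B_def)
  have \<rho>: "0 \<le> \<rho>" by (simp add: \<rho>_def)
  then have N: "real N \<le> \<rho>" "\<rho> \<le> real N + 1" unfolding N_def by linarith+
  have "\<rho> powr s = B / err (T l)"
    unfolding \<rho>_def powr_mult powr_neg_inverse_powr[OF s pos] using B s by (simp add: powr_powr)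
  then have "B / err (T l) \<le> (real N + 1) powr s"
    using powr_mono2[OF _ \<rho> N(2), of s] s by simp
  moreover obtain T' v where T': "T' \<in> \<R> T0" "card T' \<le> card T0 + N" "v \<in> X T'"
    and v: "(real N + 1) powr s * norm (u - v) < 2 * a"
    using near_best_mesh[OF a(1), of "2 * a" N] a(2) by auto
  ultimately have "B / err (T l) * norm (u - v) \<le> 2 * a"
    by (intro order_trans[OF mult_right_mono[of "B / err (T l)" "(real N + 1) powr s" "norm (u - v)"]]) auto
  then have "cea * norm (u - v) \<le> \<kappa> * err (T l)"
    using pos \<kappa>(1) a(2) by (simp add: B_def field_simps)
  then have "real (card (M l)) \<le> Cmark * (real (card T') - real (card T0))"
    by (rule card_marked_le[OF T'(1,3)])
  also have "\<dots> \<le> Cmark * \<rho>" using T'(2) N(1) Cmark by (intro mult_left_mono) auto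
  finally show ?thesis by (simp add: \<rho>_def B_def mult.assoc)
qed

lemma Cmesh_pos: "0 < Cmesh"
  using closure by (simp add: closure_estimate_def)

lemma card_le_sum_marked:
  "real (card (T l)) - real (card T0) \<le> Cmesh * (\<Sum>j<l. real (card (M j)))"
proof -
  have "\<forall>(T :: nat \<Rightarrow> 'p mesh) M.
        T 0 = T0 \<and> (\<forall>l. M l \<subseteq> T l \<and> T (Suc l) = refine (T l) (M l)) \<longrightarrow>
        (\<forall>l. real (card (T l)) - real (card T0) \<le> Cmesh * (\<Sum>j<l. real (card (M j))))"
    using closure unfolding closure_estimate_def by (rule conjunct2)
  from this[rule_format, of T M l] show ?thesis using T_0 M_subset T_refine by simp
qed

text \<open>
The elements of the initial mesh are absorbed by \<open>1 \<le> B * E\<close>, which follows from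
\<open>error_le_approx_const\<close>, at the price of the factor \<open>card T0 + 1\<close>.
\<close>

lemma upper_bound:
  assumes s: "0 < s" and a: "approx_const refine T0 X u s = ennreal a" "0 \<le> a"
  shows "real (card (T l)) powr s * err (T l) \<le> upper_const Cmesh Cest Cmark \<theta> s \<kappa> q * a"
proof (cases "err (T l) = 0")
  case True
  then show ?thesis
    using a(2) cea_ge_1 \<kappa>(1) by (simp add: upper_const_def)
next
  case False
  then have pos: "0 < err (T l)" using err_nonneg[of "T l"] by simp
  have cea: "1 \<le> cea" by (rule cea_ge_1)
  have ea: "err (T l) \<le> cea * a" by (rule error_le_approx_const[OF a])
  then have apos: "0 < a" using pos cea a(2) by (cases "a = 0") auto
  define B where "B = (2 * cea * a / \<kappa>) powr (1 / s)"
  define E where "E = err (T l) powr (- 1 / s)"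
  define S where "S = sum_const Cest \<theta> s q"
  have "real (card (M j)) \<le> Cmark * B * err (T j) powr (- 1 / s)" if "j < l" for j
  proof -
    have "0 < err (T j)"
      using pos err_quasi_monotone[of j l] that err_nonneg[of "T j"] by (cases "err (T j) = 0") auto
    then show ?thesis unfolding B_def by (rule card_marked_le_rate[OF s a(1) apos])
  qed
  then have "(\<Sum>j<l. real (card (M j))) \<le> (\<Sum>j<l. Cmark * B * err (T j) powr (- 1 / s))"
    by (intro sum_mono) simp
  also have "\<dots> = Cmark * B * (\<Sum>j<l. err (T j) powr (- 1 / s))" by (rule sum_distrib_left[symmetric])
  also have "\<dots> \<le> Cmark * B * (S * E)"
    unfolding S_def E_def sum_const_def using Cmark s pos
    by (intro mult_left_mono sum_inverse_errors) (auto simp: B_def)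
  finally have "Cmesh * (\<Sum>j<l. real (card (M j))) \<le> Cmesh * (Cmark * B * (S * E))"
    using Cmesh_pos by (intro mult_left_mono) auto
  with card_le_sum_marked[of l]
  have 1: "real (card (T l)) \<le> real (card T0) + Cmesh * Cmark * S * (B * E)"
    by (simp add: mult_ac)
  have "1 \<le> B * E"
  proof -
    have "err (T l) powr (1 / s) \<le> B"
      unfolding B_def
    proof (rule powr_mono2)
      have "cea * a \<le> 2 * cea * a / \<kappa>"
        using cea apos \<kappa> q by (simp add: field_simps)
      with ea show "err (T l) \<le> 2 * cea * a / \<kappa>" by linarith
    qed (use s pos in auto)
    then show ?thesis using pos by (simp add: E_def powr_minus_divide field_simps)
  qed
  then have "real (card T0) \<le> real (card T0) * (B * E)"
    by (simp add: mult_le_cancel_left1)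
  have S: "0 \<le> S"
    unfolding S_def sum_const_def using rate_pos[of "increment_const Cest \<theta> q"]
      rate_less_1[of "increment_const Cest \<theta> q"] s powr_less_mono2[of "1 / s" "rate (increment_const Cest \<theta> q)" 1]
    by (intro divide_nonneg_nonneg) auto
  have "real (card (T l)) \<le> (real (card T0) + Cmesh * Cmark * S) * (B * E)"
    using 1 \<open>real (card T0) \<le> real (card T0) * (B * E)\<close> by (simp add: distrib_right)
  also have "\<dots> \<le> ((real (card T0) + 1) * (1 + Cmesh * Cmark * S)) * (B * E)"
    using S Cmesh_pos Cmark \<open>1 \<le> B * E\<close> by (intro mult_right_mono) (auto simp: algebra_simps)
  finally have "real (card (T l)) powr s
      \<le> (((real (card T0) + 1) * (1 + Cmesh * Cmark * S)) * (B * E)) powr s"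
    using s by (intro powr_mono2) auto
  also have "\<dots> = ((real (card T0) + 1) * (1 + Cmesh * Cmark * S)) powr s * ((2 * cea * a / \<kappa>) / err (T l))"
    unfolding powr_mult E_def powr_neg_inverse_powr[OF s pos] B_def using s cea apos \<kappa>
    by (simp add: powr_powr)
  finally have "real (card (T l)) powr s * err (T l)
      \<le> ((real (card T0) + 1) * (1 + Cmesh * Cmark * S)) powr s * ((2 * cea * a / \<kappa>) / err (T l)) * err (T l)"
    using pos by (intro mult_right_mono) auto
  also have "\<dots> = upper_const Cmesh Cest Cmark \<theta> s \<kappa> q * a"
    using pos by (simp add: upper_const_def S_def)
  finally show ?thesis .
qed

lemma card_add_marked_le: "card (T l) + card (M l) \<le> card (T (Suc l))"
proof -
  have "M l \<subseteq> T l - T (Suc l)" unfolding T_refine by (intro marked_refined T_in M_subset)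
  then have "card (M l) \<le> card (T l - T (Suc l))" by (intro card_mono) (auto simp: finite_T)
  moreover have "card (T l) + card (T l - T (Suc l)) \<le> card (T (Suc l))"
    by (intro card_refined_le[OF son] T_in T_mono) simp
  ultimately show ?thesis by simp
qed

text \<open>
The son estimate bounds the number of sons of each element but does not say that every new
element is a son. The closure estimate bounds the new mesh directly: the elements marked so far
have each added an element, and the current ones number at most \<open>card (T l)\<close>.
\<close>

lemma card_Suc_le: "real (card (T (Suc l))) \<le> (1 + 2 * Cmesh) * real (card (T l))"
proof -
  have sum: "card T0 + (\<Sum>j<l. card (M j)) \<le> card (T l)"
  proof (induction l)
    case (Suc l)
    then show ?case using card_add_marked_le[of l] by simp
  qed (simp add: T_0)
  moreover have "card (M l) \<le> card (T l)" by (intro card_mono finite_T M_subset)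
  ultimately have "(\<Sum>j<Suc l. card (M j)) \<le> 2 * card (T l)" by simp
  then have "(\<Sum>j<Suc l. real (card (M j))) \<le> 2 * real (card (T l))"
    unfolding of_nat_sum[symmetric] by linarith
  then have "Cmesh * (\<Sum>j<Suc l. real (card (M j))) \<le> Cmesh * (2 * real (card (T l)))"
    using Cmesh_pos by (intro mult_left_mono) auto
  with card_le_sum_marked[of "Suc l"] sum show ?thesis by (simp add: distrib_right)
qed

lemma error_zero_if_unmarked: "M l = {} \<Longrightarrow> err (T l) = 0"
proof -
  assume "M l = {}"
  then have "\<theta> * (\<eta> (T l) (T l))\<^sup>2 \<le> 0" using marked[of l] by (simp add: doerfler_def \<eta>_empty)
  then have "\<eta> (T l) (T l) = 0" using \<theta>(1) by (simp add: mult_le_0_iff)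
  then have "(1 - q) * err (T l) \<le> 0" using error_le_estimator[of l] by simp
  then show ?thesis using q err_nonneg[of "T l"] by (simp add: mult_le_0_iff)
qed

text \<open>
Each \<open>N\<close> is compared with the last mesh that has at most \<open>N\<close> elements more than \<open>T0\<close>; the next
mesh has more, so \<open>N + 1\<close> is bounded by a multiple of the cardinality. Such a last mesh exists
unless the error vanishes on a mesh counted for \<open>N\<close>, because nonempty marked sets enlarge the mesh.
\<close>

lemma lower_bound:
  assumes s: "0 < s"
  shows "approx_const refine T0 X u s
    \<le> ennreal ((1 + 2 * Cmesh) powr s) * (SUP l. ennreal (real (card (T l)) powr s * err (T l)))"
  unfolding approx_const_def
proof (rule SUP_least)
  fix N :: nat
  let ?S = "{T\<in>\<R> T0. int (card T) - int (card T0) \<le> int N}"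
  let ?I = "INF T\<in>?S. INF v\<in>X T. ennreal ((real N + 1) powr s * norm (u - v))"
  let ?R = "ennreal ((1 + 2 * Cmesh) powr s) * (SUP l. ennreal (real (card (T l)) powr s * err (T l)))"
  have I_le: "?I \<le> ennreal ((real N + 1) powr s * err (T l))" if "card (T l) \<le> card T0 + N" for l
    unfolding err_def using that T_in[of l] gal_in[OF T_in]
    by (intro INF_lower2[of "T l"] INF_lower2[of "gal (T l)"]) auto
  show "?I \<le> ?R"
  proof (cases "\<exists>l. card (T l) \<le> card T0 + N \<and> err (T l) = 0")
    case True
    then obtain l where "card (T l) \<le> card T0 + N" "err (T l) = 0" by blast
    with I_le[of l] have "?I = 0" by simp
    then show ?thesis by simp
  next
    case False
    have "\<exists>l. \<not> card (T l) \<le> card T0 + N"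
    proof (rule ccontr)
      assume *: "\<nexists>l. \<not> card (T l) \<le> card T0 + N"
      have "card T0 + l \<le> card (T l)" for l
      proof (induction l)
        case (Suc l)
        have "M l \<noteq> {}" using error_zero_if_unmarked False * by blast
        then have "0 < card (M l)" using finite_subset[OF M_subset finite_T] by (simp add: card_gt_0_iff)
        then show ?case using Suc card_add_marked_le[of l] by simp
      qed (simp add: T_0)
      from this[of "Suc N"] * show False by (metis add_Suc_right not_less_eq_eq order_trans)
    qed
    then obtain l where l: "\<not> card (T l) \<le> card T0 + N"
      and least: "\<And>j. j < l \<Longrightarrow> card (T j) \<le> card T0 + N"
      using exists_least_iff[of "\<lambda>l. \<not> card (T l) \<le> card T0 + N"] by auto
    have "l \<noteq> 0" using l by (intro notI) (simp add: T_0)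
    then obtain k where k: "l = Suc k" by (cases l) auto
    have "real N + 1 \<le> real (card (T (Suc k)))" using l[unfolded k] by linarith
    then have "real N + 1 \<le> (1 + 2 * Cmesh) * real (card (T k))" using card_Suc_le[of k] by linarith
    then have "(real N + 1) powr s \<le> ((1 + 2 * Cmesh) * real (card (T k))) powr s"
      using s by (intro powr_mono2) auto
    also have "\<dots> = (1 + 2 * Cmesh) powr s * real (card (T k)) powr s"
      using Cmesh_pos by (simp add: powr_mult)
    finally have "(real N + 1) powr s * err (T k)
        \<le> (1 + 2 * Cmesh) powr s * (real (card (T k)) powr s * err (T k))"
      using err_nonneg[of "T k"] by (simp add: mult_right_mono flip: mult.assoc)
    then have "ennreal ((real N + 1) powr s * err (T k))
        \<le> ennreal ((1 + 2 * Cmesh) powr s) * ennreal (real (card (T k)) powr s * err (T k))"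
      using err_nonneg by (subst ennreal_mult[symmetric]) (auto intro: ennreal_leI)
    also have "\<dots> \<le> ?R" by (intro mult_left_mono SUP_upper) auto
    finally show ?thesis using I_le[of k] least[of k] k by (meson lessI order_trans)
  qed
qed

end

section \<open>The two-level estimator and the optimality theorem\<close>

lemma tau_set_nonneg: "0 \<le> tau_set I JT \<tau> TH U"
  by (simp add: tau_set_def sum_nonneg)

lemma tau_set_mono:
  assumes "finite TH" "U \<subseteq> V" "V \<subseteq> TH"
  shows "tau_set I JT \<tau> TH U \<le> tau_set I JT \<tau> TH V"
  unfolding tau_set_def using assms
  by (intro real_sqrt_le_mono sum_mono2) (auto intro: finite_subset)

lemma ennreal_inverse_mult_le:
  assumes "A \<le> ennreal C' * S" "0 < C" "C' \<le> C"
  shows "ennreal (inverse C) * A \<le> S"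
proof -
  have "ennreal (inverse C) * A \<le> ennreal (inverse C) * (ennreal C * S)"
    using assms(3)
    by (intro mult_left_mono order_trans[OF assms(1)] mult_right_mono ennreal_leI) auto
  also have "\<dots> = ennreal (inverse C * C) * S"
    using assms(2) by (subst ennreal_mult) (auto simp: mult.assoc)
  also have "\<dots> = S" using assms(2) by simp
  finally show ?thesis .
qed

theorem theorem9:
  fixes smul :: "'k::real_or_complex \<Rightarrow> 'h::banach \<Rightarrow> 'h"
    and ip :: "'h \<Rightarrow> 'h \<Rightarrow> 'k"
    and K :: "'h \<Rightarrow> ('h \<Rightarrow>\<^sub>L 'k)"
    and refine :: "'p mesh \<Rightarrow> 'p mesh \<Rightarrow> 'p mesh"
    and T0 :: "'p mesh"
    and X :: "'p mesh \<Rightarrow> 'h set"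
    and I J :: "'p mesh \<Rightarrow> 'z set"
    and JT :: "'p mesh \<Rightarrow> 'p set \<Rightarrow> 'z set"
    and Cson Cmesh \<gamma>0 Cest Cstab Cmark :: real
  assumes "hilbert_space smul ip"
    and "compact_operator smul K"
    and "mesh_refinement refine T0"
    and "son_estimate refine T0 Cson"
    and "overlay_estimate refine T0"
    and "closure_estimate refine T0 Cmesh"
    and "discretization smul (bform ip K) refine T0 X \<gamma>0"
    and "dof_sets refine T0 I J JT"
    and "0 < Cest" and "0 < Cstab" and "1 \<le> Cmark"
  shows "\<exists>Copt :: real \<Rightarrow> real \<Rightarrow> real \<Rightarrow> real \<Rightarrow> nat \<Rightarrow> real.
    \<forall>(F :: 'h \<Rightarrow>\<^sub>L 'k) (u :: 'h) (\<tau> :: 'p mesh \<Rightarrow> 'z \<Rightarrow> real) (\<kappa> :: real) (q :: real).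
      let g = (\<lambda>TH. galerkin (bform ip K) F (X TH));
          \<eta> = tau_set I JT \<tau>
      in
        F \<in> dual_space smul \<and>
        (\<exists>!w. \<forall>v. bform ip K w v = blinfun_apply F v) \<and>
        (\<forall>v. bform ip K u v = blinfun_apply F v) \<and>
        (\<forall>TH\<in>refinements refine T0. \<forall>z\<in>J TH - I TH. 0 \<le> \<tau> TH z) \<and>
        discrete_efficiency_reliability refine T0 \<eta> g Cest \<and>
        stability refine T0 \<eta> g Cstab \<and>
        0 < \<kappa> \<and> \<kappa> \<le> q \<and> q < 1
        \<longrightarrow>
        (\<exists>\<theta>opt. 0 < \<theta>opt \<and> \<theta>opt \<le> 1 \<and>
          (\<forall>\<theta> T.
             0 < \<theta> \<and> \<theta> < \<theta>opt \<and>
             adaptive_output refine T0 \<eta> \<theta> Cmark T \<and>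
             strong_saturation refine g u T \<kappa> q
             \<longrightarrow>
             (\<exists>l0. linear_convergence_index g u T l0) \<and>
             (\<forall>s>0. \<forall>l0. linear_convergence_index g u T l0 \<longrightarrow>
                0 < Copt \<theta> s \<kappa> q l0 \<and>
                ennreal (inverse (Copt \<theta> s \<kappa> q l0)) * approx_const refine T0 X u s
                  \<le> (SUP l. ennreal (real (card (T l)) powr s * norm (u - g (T l)))) \<and>
                (SUP l. ennreal (real (card (T l)) powr s * norm (u - g (T l))))
                  \<le> ennreal (Copt \<theta> s \<kappa> q l0) * approx_const refine T0 X u s)))"
proof -
  interpret hilbert_space smul ip by fact
  obtain CK where CK: "0 \<le> CK" "\<And>x. norm (K x) \<le> CK * norm x"
    using compact_operator_bounded[OF \<open>compact_operator smul K\<close>] by blast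
  interpret D: stable_discretization smul ip refine T0 K X \<gamma>0 CK
    using assms CK by (intro stable_discretization.intro stable_discretization_axioms.intro) auto
  define Copt where "Copt \<theta> s \<kappa> q (l0 :: nat) =
    max (D.upper_const Cmesh Cest Cmark \<theta> s \<kappa> q) ((1 + 2 * Cmesh) powr s)" for \<theta> s \<kappa> q l0
  have Cmesh: "0 < Cmesh"
    using \<open>closure_estimate refine T0 Cmesh\<close> by (simp add: closure_estimate_def)
  have Copt_pos: "0 < Copt \<theta> s \<kappa> q l0" for \<theta> s \<kappa> q l0
    using Cmesh by (simp add: Copt_def less_max_iff_disj)
  show ?thesis
    unfolding Let_def
  proof (rule exI[of _ Copt], intro allI impI, elim conjE)
    fix F :: "'h \<Rightarrow>\<^sub>L 'k" and u :: 'h and \<tau> :: "'p mesh \<Rightarrow> 'z \<Rightarrow> real" and \<kappa> q :: real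
    let ?g = "\<lambda>TH. galerkin (bform ip K) F (X TH)" and ?\<eta> = "tau_set I JT \<tau>"
    assume F: "F \<in> dual_space smul" and u: "\<forall>v. bform ip K u v = blinfun_apply F v"
      and eff: "discrete_efficiency_reliability refine T0 ?\<eta> ?g Cest"
      and \<kappa>: "0 < \<kappa>" "\<kappa> \<le> q" and q: "q < 1"
    interpret G: galerkin_solution smul ip refine T0 K X \<gamma>0 CK F u
      by unfold_locales (use F u in auto)
    let ?\<theta>opt = "min 1 (D.theta_bound Cest q)"
    have "0 < D.theta_bound Cest q"
      using \<open>0 < Cest\<close> q D.cea_ge_1 by (simp add: D.theta_bound_def)
    moreover
    {
      fix \<theta> T
      assume \<theta>: "0 < \<theta>" "\<theta> < ?\<theta>opt" and out: "adaptive_output refine T0 ?\<eta> \<theta> Cmark T"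
        and sat: "strong_saturation refine ?g u T \<kappa> q"
      from out obtain M where M: "T 0 = T0" "\<And>l. doerfler ?\<eta> \<theta> (T l) (M l)"
        "\<And>l. real (card (M l)) \<le> Cmark * real (Min (card ` {U. doerfler ?\<eta> \<theta> (T l) U}))"
        "\<And>l. T (Suc l) = refine (T l) (M l)"
        unfolding adaptive_output_def by metis
      interpret A: adaptive_run smul ip refine T0 K X \<gamma>0 CK F u ?\<eta> Cson Cmesh Cest Cmark \<kappa> q \<theta> T M
      proof unfold_locales
        show "?\<eta> TH U \<le> ?\<eta> TH V" if "TH \<in> refinements refine T0" "U \<subseteq> V" "V \<subseteq> TH" for TH U V
          using that D.finite_mesh by (intro tau_set_mono)
        show "?\<eta> TH {} = 0" for TH by (simp add: tau_set_def)
        show "\<theta> \<le> D.theta_bound Cest q" using \<theta>(2) by simp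
      qed (fact assms M sat eff \<kappa> q \<theta> tau_set_nonneg)+
      have "\<exists>l0. linear_convergence_index ?g u T l0" by (rule A.eventually_contractive)
      moreover
      {
        fix s :: real and l0 :: nat
        assume s: "0 < s"
        let ?C = "Copt \<theta> s \<kappa> q l0"
        let ?S = "SUP l. ennreal (real (card (T l)) powr s * norm (u - ?g (T l)))"
        have "ennreal (inverse ?C) * approx_const refine T0 X u s \<le> ?S"
          by (rule ennreal_inverse_mult_le[OF A.lower_bound[OF s, unfolded G.err_def] Copt_pos])
            (simp add: Copt_def)
        moreover have "?S \<le> ennreal ?C * approx_const refine T0 X u s"
        proof (cases "approx_const refine T0 X u s" rule: ennreal_cases)
          case (real a)
          have "real (card (T l)) powr s * norm (u - ?g (T l)) \<le> ?C * a" for l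
          proof -
            have "real (card (T l)) powr s * norm (u - ?g (T l))
                \<le> D.upper_const Cmesh Cest Cmark \<theta> s \<kappa> q * a"
              using A.upper_bound[OF s real(2,1)] by (simp add: G.err_def)
            also have "\<dots> \<le> ?C * a" using real(1) by (intro mult_right_mono) (simp_all add: Copt_def)
            finally show ?thesis .
          qed
          then have "?S \<le> ennreal (?C * a)" by (intro SUP_least ennreal_leI)
          also have "\<dots> = ennreal ?C * approx_const refine T0 X u s"
            using real less_imp_le[OF Copt_pos] by (simp add: ennreal_mult)
          finally show ?thesis .
        next
          case top
          then show ?thesis using Copt_pos[of \<theta> s \<kappa> q l0] by (simp add: ennreal_mult_top)
        qed
        ultimately have "0 < ?C \<and> ennreal (inverse ?C) * approx_const refine T0 X u s \<le> ?S \<and>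
            ?S \<le> ennreal ?C * approx_const refine T0 X u s"
          using Copt_pos by blast
      }
      ultimately have "(\<exists>l0. linear_convergence_index ?g u T l0) \<and>
          (\<forall>s>0. \<forall>l0. linear_convergence_index ?g u T l0 \<longrightarrow> 0 < Copt \<theta> s \<kappa> q l0 \<and>
            ennreal (inverse (Copt \<theta> s \<kappa> q l0)) * approx_const refine T0 X u s
              \<le> (SUP l. ennreal (real (card (T l)) powr s * norm (u - ?g (T l)))) \<and>
            (SUP l. ennreal (real (card (T l)) powr s * norm (u - ?g (T l))))
              \<le> ennreal (Copt \<theta> s \<kappa> q l0) * approx_const refine T0 X u s)"
        by blast
    }
    ultimately show "\<exists>\<theta>opt. 0 < \<theta>opt \<and> \<theta>opt \<le> 1 \<and>
      (\<forall>\<theta> T. 0 < \<theta> \<and> \<theta> < \<theta>opt \<and> adaptive_output refine T0 ?\<eta> \<theta> Cmark T \<and>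
          strong_saturation refine ?g u T \<kappa> q \<longrightarrow>
        (\<exists>l0. linear_convergence_index ?g u T l0) \<and>
        (\<forall>s>0. \<forall>l0. linear_convergence_index ?g u T l0 \<longrightarrow> 0 < Copt \<theta> s \<kappa> q l0 \<and>
            ennreal (inverse (Copt \<theta> s \<kappa> q l0)) * approx_const refine T0 X u s
              \<le> (SUP l. ennreal (real (card (T l)) powr s * norm (u - ?g (T l)))) \<and>
            (SUP l. ennreal (real (card (T l)) powr s * norm (u - ?g (T l))))
              \<le> ennreal (Copt \<theta> s \<kappa> q l0) * approx_const refine T0 X u s))"
      by (intro exI[of _ ?\<theta>opt] conjI allI impI) auto
  qed
qed

end
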